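(* There is an algorithm which, given an XOR-CNF formula $\varphi = C_1 \land \dots \land C_m$, enumerates the set of all signatures of $\varphi$ (each exactly once) with polynomial delay and using polynomial space.
   Context: An XOR-clause over a set of Boolean variables $V=\{x_1,\dots,x_n\}$ is a linear equation $x_{i_1} + \dots + x_{i_k} = \varepsilon$ over the two-element field $\mathrm{GF}(2)$, with $\varepsilon\in\{0,1\}$. An XOR-CNF is a conjunction $\varphi = C_1\land\dots\land C_m$ of XOR-clauses; its size is the total number of variable occurrences in its clauses. For an assignment $a\colon V\to\{0,1\}$, $C_i(a)=1$ if the equation $C_i$ holds under $a$ and $C_i(a)=0$ otherwise. The signature produced by $a$ is the binary sequence $\sigma_\varphi(a) = (C_1(a),\dots,C_m(a))\in\{0,1\}^m$; a signature of $\varphi$ is any sequence of the form $\sigma_\varphi(a)$. Polynomial delay means the time before the first output, between consecutive outputs, and after the last output is bounded by a polynomial in the input size; polynomial space means the working memory (not counting outputs, which are output and discarded) is polynomial in the input size. *)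

theory Defs
  imports Main "HOL-Library.Z2" "HOL-Library.FuncSet" "HOL-Computational_Algebra.Polynomial"
begin

section \<open>XOR-CNF formulas and their signatures\<close>

text \<open>The pair \<open>([i\<^sub>1, \<dots>, i\<^sub>k], \<epsilon>)\<close> is the equation \<open>x\<^bsub>i\<^sub>1\<^esub> + \<dots> + x\<^bsub>i\<^sub>k\<^esub> = \<epsilon>\<close> over the
  two-element field \<^typ>\<open>bit\<close>. Repeated variables and \<open>k = 0\<close> are allowed.\<close>

type_synonym xor_clause = "nat list \<times> bit"
type_synonym xor_cnf = "xor_clause list"

definition clause_holds :: "xor_clause \<Rightarrow> (nat \<Rightarrow> bit) \<Rightarrow> bool" where
  "clause_holds C a \<longleftrightarrow> (\<Sum>i\<leftarrow>fst C. a i) = snd C"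

definition clause_value :: "xor_clause \<Rightarrow> (nat \<Rightarrow> bit) \<Rightarrow> bit" where
  "clause_value C a = (if clause_holds C a then 1 else 0)"

definition signature :: "xor_cnf \<Rightarrow> (nat \<Rightarrow> bit) \<Rightarrow> bit list" where
  "signature \<phi> a = map (\<lambda>C. clause_value C a) \<phi>"

definition signatures :: "xor_cnf \<Rightarrow> bit list set" where
  "signatures \<phi> = range (signature \<phi>)"

definition cnf_vars :: "xor_cnf \<Rightarrow> nat set" where
  "cnf_vars \<phi> = (\<Union>C\<in>set \<phi>. set (fst C))"

definition cnf_size :: "xor_cnf \<Rightarrow> nat" where
  "cnf_size \<phi> = (\<Sum>C\<leftarrow>\<phi>. length (fst C))"

text \<open>Assignments are total on \<^typ>\<open>nat\<close>; this gives the same signatures as assignments of any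
  variable set \<open>V\<close> containing the variables of the formula.\<close>

lemma signature_cong:
  assumes "\<And>i. i \<in> cnf_vars \<phi> \<Longrightarrow> a i = b i"
  shows "signature \<phi> a = signature \<phi> b"
proof -
  have "clause_value C a = clause_value C b" if "C \<in> set \<phi>" for C
  proof -
    have "map a (fst C) = map b (fst C)"
      using that assms by (auto simp: cnf_vars_def)
    then show ?thesis
      unfolding clause_value_def clause_holds_def by (simp only:)
  qed
  then show ?thesis
    by (simp add: signature_def)
qed

lemma signatures_eq_image_PiE:
  assumes "cnf_vars \<phi> \<subseteq> V"
  shows "signatures \<phi> = signature \<phi> ` (V \<rightarrow>\<^sub>E UNIV)"
proof -
  have "signature \<phi> a = signature \<phi> (restrict a V)" for a
    using assms by (intro signature_cong) auto
  moreover have "restrict a V \<in> V \<rightarrow>\<^sub>E UNIV" for a :: "nat \<Rightarrow> bit"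
    by auto
  ultimately show ?thesis
    unfolding signatures_def by blast
qed


section \<open>The machine model\<close>

text \<open>Algorithms are programs of the WHILE language over binary trees (N. D. Jones,
  \<^emph>\<open>Computability and Complexity\<close>), extended by a command that outputs a value. The size of a tree
  is the number of its \<open>CONS\<close> cells, without sharing, so that a tree \<open>v\<close> can be written with
  \<open>2 * size v + 1\<close> bits.\<close>

datatype data = NIL | CONS data data

fun hd_data :: "data \<Rightarrow> data" where
  "hd_data NIL = NIL"
| "hd_data (CONS u v) = u"

fun tl_data :: "data \<Rightarrow> data" where
  "tl_data NIL = NIL"
| "tl_data (CONS u v) = v"

type_synonym store = "nat \<Rightarrow> data"

datatype exp = Var nat | Nil_exp | Cons_exp exp exp | Hd exp | Tl exp

fun eval :: "exp \<Rightarrow> store \<Rightarrow> data" where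
  "eval (Var x) s = s x"
| "eval Nil_exp s = NIL"
| "eval (Cons_exp e f) s = CONS (eval e s) (eval f s)"
| "eval (Hd e) s = hd_data (eval e s)"
| "eval (Tl e) s = tl_data (eval e s)"

text \<open>Time is charged at bit cost: evaluating an expression costs the sizes of all values
  that arise, as if each of them were copied.\<close>

fun exp_cost :: "exp \<Rightarrow> store \<Rightarrow> nat" where
  "exp_cost (Var x) s = 1 + size (s x)"
| "exp_cost Nil_exp s = 1"
| "exp_cost (Cons_exp e f) s = 1 + size (eval (Cons_exp e f) s) + exp_cost e s + exp_cost f s"
| "exp_cost (Hd e) s = 1 + size (eval (Hd e) s) + exp_cost e s"
| "exp_cost (Tl e) s = 1 + size (eval (Tl e) s) + exp_cost e s"

datatype com =
    Skip
  | Assign nat exp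
  | Emit exp
  | Seq com com
  | If exp com com
  | While exp com

text \<open>One event per elementary step: its cost, the value it outputs (if any), and the store
  after the step.\<close>

datatype event = Event (cost: nat) (emitted: "data option") (store_after: store)

text \<open>\<open>exec c s tr t\<close>: started in store \<open>s\<close>, the command \<open>c\<close> halts in store \<open>t\<close>, and the sequence of
  steps performed is \<open>tr\<close>. As in Jones, a value is true as a condition iff it is not \<open>NIL\<close>.\<close>

inductive exec :: "com \<Rightarrow> store \<Rightarrow> event list \<Rightarrow> store \<Rightarrow> bool" where
  Skip: "exec Skip s [Event 1 None s] s"
| Assign: "t = s(x := eval e s) \<Longrightarrow> exec (Assign x e) s [Event (exp_cost e s) None t] t"
| Emit: "exec (Emit e) s [Event (exp_cost e s) (Some (eval e s)) s] s"
| Seq: "exec c s tr t \<Longrightarrow> exec d t tr' u \<Longrightarrow> exec (Seq c d) s (tr @ tr') u"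
| IfTrue: "eval e s \<noteq> NIL \<Longrightarrow> exec c s tr t \<Longrightarrow>
    exec (If e c d) s (Event (exp_cost e s) None s # tr) t"
| IfFalse: "eval e s = NIL \<Longrightarrow> exec d s tr t \<Longrightarrow>
    exec (If e c d) s (Event (exp_cost e s) None s # tr) t"
| WhileTrue: "eval e s \<noteq> NIL \<Longrightarrow> exec c s tr t \<Longrightarrow> exec (While e c) t tr' u \<Longrightarrow>
    exec (While e c) s (Event (exp_cost e s) None s # tr @ tr') u"
| WhileFalse: "eval e s = NIL \<Longrightarrow> exec (While e c) s [Event (exp_cost e s) None s] s"

inductive_cases exec_elims:
  "exec Skip s tr t" "exec (Assign x e) s tr t" "exec (Emit e) s tr t" "exec (Seq c d) s tr t"
  "exec (If e c d) s tr t" "exec (While e c) s tr t"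

lemma exec_deterministic:
  "exec c s tr t \<Longrightarrow> exec c s tr' t' \<Longrightarrow> tr' = tr \<and> t' = t"
proof (induction arbitrary: tr' t' rule: exec.induct)
  case (Seq c s tr t d tr2 u)
  from Seq.prems obtain tr1 t1 tr1' where "exec c s tr1 t1" "exec d t1 tr1' t'" "tr' = tr1 @ tr1'"
    by (rule exec_elims)
  with Seq.IH show ?case by metis
next
  case (IfTrue e s c tr t d)
  from IfTrue.prems IfTrue.hyps obtain tr1 where
    "exec c s tr1 t'" "tr' = Event (exp_cost e s) None s # tr1"
    by (auto elim: exec_elims(5))
  with IfTrue.IH show ?case by metis
next
  case (IfFalse e s d tr t c)
  from IfFalse.prems IfFalse.hyps obtain tr1 where
    "exec d s tr1 t'" "tr' = Event (exp_cost e s) None s # tr1"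
    by (auto elim: exec_elims(5))
  with IfFalse.IH show ?case by metis
next
  case (WhileTrue e s c tr t tr2 u)
  from WhileTrue.prems obtain tr1 t1 tr1' where
    "exec c s tr1 t1" "exec (While e c) t1 tr1' t'"
    "tr' = Event (exp_cost e s) None s # tr1 @ tr1'"
    by (rule exec_elims(6)) (use WhileTrue.hyps(1) in auto)
  with WhileTrue.IH show ?case by metis
next
  case (WhileFalse e s c)
  from WhileFalse.prems show ?case
    by (rule exec_elims(6)) (use WhileFalse.hyps in auto)
qed (auto elim: exec_elims(1-3))

definition initial_store :: "data \<Rightarrow> store" where
  "initial_store v = (\<lambda>x. NIL)(0 := v)"

definition outputs :: "event list \<Rightarrow> data list" where
  "outputs tr = List.map_filter emitted tr"

text \<open>The times before the first output, between consecutive outputs and after the last output;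
  \<open>n\<close> is the time elapsed since the previous output, or since the start.\<close>

fun delays_from :: "nat \<Rightarrow> event list \<Rightarrow> nat list" where
  "delays_from n [] = [n]"
| "delays_from n (Event k None s # tr) = delays_from (n + k) tr"
| "delays_from n (Event k (Some v) s # tr) = (n + k) # delays_from 0 tr"

definition delays :: "event list \<Rightarrow> nat list" where
  "delays tr = delays_from 0 tr"

fun exp_vars :: "exp \<Rightarrow> nat set" where
  "exp_vars (Var x) = {x}"
| "exp_vars Nil_exp = {}"
| "exp_vars (Cons_exp e f) = exp_vars e \<union> exp_vars f"
| "exp_vars (Hd e) = exp_vars e"
| "exp_vars (Tl e) = exp_vars e"

fun com_vars :: "com \<Rightarrow> nat set" where
  "com_vars Skip = {}"
| "com_vars (Assign x e) = insert x (exp_vars e)"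
| "com_vars (Emit e) = exp_vars e"
| "com_vars (Seq c d) = com_vars c \<union> com_vars d"
| "com_vars (If e c d) = exp_vars e \<union> com_vars c \<union> com_vars d"
| "com_vars (While e c) = exp_vars e \<union> com_vars c"

lemma finite_exp_vars: "finite (exp_vars e)"
  by (induction e) auto

lemma finite_com_vars: "finite (com_vars c)"
  by (induction c) (auto simp: finite_exp_vars)

text \<open>The total size of the program variables, the one holding the input included. What is not
  counted is bounded for a fixed program: there is no recursion, so the control state ranges over a
  finite set, and temporaries of an expression exceed the store by at most a constant factor.\<close>

definition space :: "com \<Rightarrow> store \<Rightarrow> nat" where
  "space P s = (\<Sum>x\<in>com_vars P. size (s x))"

definition space_bounded :: "com \<Rightarrow> store \<Rightarrow> event list \<Rightarrow> nat \<Rightarrow> bool" where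
  "space_bounded P s tr b \<longleftrightarrow> space P s \<le> b \<and> (\<forall>ev\<in>set tr. space P (store_after ev) \<le> b)"

definition delay_bounded :: "event list \<Rightarrow> nat \<Rightarrow> bool" where
  "delay_bounded tr b \<longleftrightarrow> (\<forall>d\<in>set (delays tr). d \<le> b)"


section \<open>Encoding of inputs and outputs\<close>

definition enc_list :: "('a \<Rightarrow> data) \<Rightarrow> 'a list \<Rightarrow> data" where
  "enc_list f xs = foldr (\<lambda>x v. CONS (f x) v) xs NIL"

definition enc_bit :: "bit \<Rightarrow> data" where
  "enc_bit b = (if b = 0 then NIL else CONS NIL NIL)"

text \<open>Variable indices are written in binary, least significant bit first.\<close>

fun binary :: "nat \<Rightarrow> bit list" where
  "binary n = (if n = 0 then [] else of_nat n # binary (n div 2))"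

declare binary.simps [simp del]

definition enc_nat :: "nat \<Rightarrow> data" where
  "enc_nat n = enc_list enc_bit (binary n)"

definition enc_clause :: "xor_clause \<Rightarrow> data" where
  "enc_clause C = CONS (enc_bit (snd C)) (enc_list enc_nat (fst C))"

definition enc_cnf :: "xor_cnf \<Rightarrow> data" where
  "enc_cnf \<phi> = enc_list enc_clause \<phi>"

definition enc_signature :: "bit list \<Rightarrow> data" where
  "enc_signature \<sigma> = enc_list enc_bit \<sigma>"

lemma enc_list_simps [simp]:
  "enc_list f [] = NIL"
  "enc_list f (x # xs) = CONS (f x) (enc_list f xs)"
  by (simp_all add: enc_list_def)

lemma inj_enc_list:
  assumes "inj f"
  shows "inj (enc_list f)"
proof (rule injI)
  fix xs ys
  show "enc_list f xs = enc_list f ys \<Longrightarrow> xs = ys"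
  proof (induction xs arbitrary: ys)
    case Nil
    then show ?case by (cases ys) auto
  next
    case (Cons x xs)
    then show ?case by (cases ys) (auto dest: injD [OF assms])
  qed
qed

lemma inj_enc_bit: "inj enc_bit"
  by (rule injI) (auto simp: enc_bit_def split: if_splits)

lemma inj_binary: "inj binary"
proof (rule injI)
  fix m n
  show "binary m = binary n \<Longrightarrow> m = n"
  proof (induction m arbitrary: n rule: less_induct)
    case (less m)
    show ?case
    proof (cases "m = 0 \<or> n = 0")
      case True
      with less.prems show ?thesis
        by (auto simp: binary.simps [of m] binary.simps [of n] split: if_splits)
    next
      case False
      with less.prems have "(of_nat m :: bit) = of_nat n" "binary (m div 2) = binary (n div 2)"
        by (simp_all add: binary.simps [of m] binary.simps [of n])
      moreover from this False have "m div 2 = n div 2"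
        by (intro less.IH) auto
      moreover have "(of_nat k :: bit) = of_bool (odd k)" for k
        by (induction k) auto
      ultimately have "m mod 2 = n mod 2" "m div 2 = n div 2"
        by (auto simp: mod2_eq_if split: if_splits)
      then show ?thesis
        by (metis div_mult_mod_eq)
    qed
  qed
qed

lemma inj_enc_nat: "inj enc_nat"
  using inj_compose [OF inj_enc_list [OF inj_enc_bit] inj_binary]
  by (simp add: enc_nat_def [abs_def] comp_def)

lemma inj_enc_clause: "inj enc_clause"
  by (rule injI)
    (auto simp: enc_clause_def prod_eq_iff
      dest: injD [OF inj_enc_bit] injD [OF inj_enc_list [OF inj_enc_nat]])

lemma inj_enc_cnf: "inj enc_cnf"
  using inj_enc_list [OF inj_enc_clause] by (simp add: enc_cnf_def [abs_def])

lemma inj_enc_signature: "inj enc_signature"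
  using inj_enc_list [OF inj_enc_bit] by (simp add: enc_signature_def [abs_def])

text \<open>The input size is \<open>size (enc_cnf \<phi>)\<close>. It dominates the number of variable occurrences plus
  the number of clauses, and conversely it is at most quadratic in the number of variable
  occurrences when no clause is empty and no index exceeds this number, which holds in particular if
  the variables occurring are \<open>x\<^sub>1, \<dots>, x\<^sub>n\<close>.\<close>

lemma size_enc_list: "size (enc_list f xs) = length xs + (\<Sum>x\<leftarrow>xs. size (f x))"
  by (induction xs) auto

lemma cnf_size_le_size_enc: "cnf_size \<phi> + length \<phi> \<le> size (enc_cnf \<phi>)"
  by (induction \<phi>) (auto simp: enc_cnf_def cnf_size_def enc_clause_def size_enc_list)

lemma size_enc_bit: "size (enc_bit b) \<le> 1"
  by (simp add: enc_bit_def)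

lemma length_binary: "n < 2 ^ L \<Longrightarrow> length (binary n) \<le> L"
proof (induction L arbitrary: n)
  case 0
  then show ?case by (simp add: binary.simps)
next
  case (Suc L)
  then have "length (binary (n div 2)) \<le> L"
    by (intro Suc.IH) auto
  then show ?case
    by (subst binary.simps) auto
qed

lemma size_enc_nat:
  assumes "n < 2 ^ L"
  shows "size (enc_nat n) \<le> 2 * L"
proof -
  have "(\<Sum>b\<leftarrow>bs. size (enc_bit b)) \<le> length bs" for bs
    by (induction bs) (use add_mono [OF size_enc_bit] in auto)
  from this [of "binary n"] length_binary [OF assms] show ?thesis
    by (simp add: enc_nat_def size_enc_list)
qed

lemma size_enc_cnf_le:
  assumes "\<And>i. i \<in> cnf_vars \<phi> \<Longrightarrow> i < 2 ^ L"
  shows "size (enc_cnf \<phi>) \<le> 3 * length \<phi> + (2 * L + 1) * cnf_size \<phi>"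
  using assms
proof (induction \<phi>)
  case Nil
  then show ?case by (simp add: enc_cnf_def)
next
  case (Cons C \<phi>)
  have *: "size (enc_list enc_nat is) \<le> (2 * L + 1) * length is"
    if "\<forall>i\<in>set is. i < 2 ^ L" for "is"
    using that by (induction "is") (use size_enc_nat [of _ L] in \<open>force+\<close>)
  have "size (enc_clause C) \<le> 2 + (2 * L + 1) * length (fst C)"
    using * [of "fst C"] Cons.prems size_enc_bit [of "snd C"]
    by (auto simp: enc_clause_def cnf_vars_def)
  moreover have "size (enc_cnf \<phi>) \<le> 3 * length \<phi> + (2 * L + 1) * cnf_size \<phi>"
    using Cons by (auto simp: cnf_vars_def)
  ultimately show ?case
    by (simp add: enc_cnf_def cnf_size_def algebra_simps)
qed

lemma size_enc_cnf_le_cnf_size: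
  assumes "\<And>C. C \<in> set \<phi> \<Longrightarrow> fst C \<noteq> []"
    and "\<And>i. i \<in> cnf_vars \<phi> \<Longrightarrow> i \<le> cnf_size \<phi>"
  shows "size (enc_cnf \<phi>) \<le> 2 * cnf_size \<phi> ^ 2 + 4 * cnf_size \<phi>"
proof -
  have "length \<phi> \<le> cnf_size \<phi>"
    using assms(1)
  proof (induction \<phi>)
    case (Cons C \<phi>)
    then have "length \<phi> \<le> cnf_size \<phi>" "length (fst C) \<ge> 1"
      by (auto simp: Suc_le_eq)
    then show ?case by (simp add: cnf_size_def)
  qed simp
  moreover have "size (enc_cnf \<phi>) \<le> 3 * length \<phi> + (2 * cnf_size \<phi> + 1) * cnf_size \<phi>"
    using assms(2) less_exp [of "cnf_size \<phi>"] by (intro size_enc_cnf_le) (metis le_less_trans)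
  ultimately show ?thesis
    by (simp add: power2_eq_square algebra_simps)
qed

end

theory Submission
  imports Defs
begin

text \<open>Up to a constant offset, the signatures of \<open>\<phi>\<close> form the column space of the coefficient matrix of
  \<open>\<phi>\<close> over the two-element field. The machine computes the column of each variable occurrence and
  inserts it into an echelon basis by Gaussian elimination, in polynomial time. It then runs through the
  span of this basis like a binary counter: the successor of an element is computed in polynomial time
  from the element and the basis, and by linear independence no element is visited twice. Between two outputs
  only the basis, the offset and the current element have to be stored.\<close>

section \<open>Timed execution\<close>

text \<open>The span may be exponentially large, so the total time cannot bound the space. Each
  round therefore starts in a store \<open>main_store\<close>, whose size is bounded in terms of the
  formula alone; within a round a step pays for what it stores, so the excess is at most the time of
  one round. Costs depend on tree sizes, and an exact account would be unwieldy. Instead one number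
  \<open>z\<close>, quadratic in the input size, exceeds the size of every variable at the control
  points of the program. Given this, the cost of a command is at most a polynomial in
  \<open>z\<close> read off its syntax, and what remains for each piece is functional: which store
  it reaches, and why this store stays below \<open>z\<close>. The machine has no recursion, so
  \<open>insert_vec\<close> and \<open>next_vec\<close> are matched by loops that are a
  \<open>fold\<close> with an accumulator and build their results in reverse. No counter is kept
  besides the current element. Its entry at a leading position is its coordinate there, once the
  earlier basis vectors have been removed from it.\<close>

definition runs :: "com \<Rightarrow> store \<Rightarrow> nat \<Rightarrow> store \<Rightarrow> bool" where
  "runs c s k t \<longleftrightarrow> (\<exists>tr. exec c s tr t \<and> outputs tr = [] \<and> sum_list (map cost tr) \<le> k)"

lemma outputs_simps [simp]:
  "outputs [] = []"
  "outputs (Event k None s # tr) = outputs tr"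
  "outputs (Event k (Some v) s # tr) = v # outputs tr"
  "outputs (tr @ tr') = outputs tr @ outputs tr'"
  by (simp_all add: outputs_def List.map_filter_def)

lemma runs_mono: "runs c s k t \<Longrightarrow> k \<le> l \<Longrightarrow> runs c s l t"
  unfolding runs_def using le_trans by blast

lemma runs_Seq: "runs c s k t \<Longrightarrow> runs d t l u \<Longrightarrow> runs (Seq c d) s (k + l) u"
  unfolding runs_def by (fastforce dest: exec.Seq intro: add_mono)

lemma runs_IfTrue:
  "eval e s \<noteq> NIL \<Longrightarrow> runs c s k t \<Longrightarrow> exp_cost e s \<le> j \<Longrightarrow> runs (If e c d) s (j + k) t"
  unfolding runs_def by (fastforce dest: exec.IfTrue intro: add_mono)

lemma runs_IfFalse:
  "eval e s = NIL \<Longrightarrow> runs d s k t \<Longrightarrow> exp_cost e s \<le> j \<Longrightarrow> runs (If e c d) s (j + k) t"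
  unfolding runs_def by (fastforce dest: exec.IfFalse intro: add_mono)

lemma runs_WhileTrue:
  assumes "eval e s \<noteq> NIL" "runs c s k t" "runs (While e c) t l u" "exp_cost e s \<le> j"
  shows "runs (While e c) s (j + k + l) u"
  using assms unfolding runs_def by (fastforce dest: exec.WhileTrue intro: add_mono)

lemma runs_WhileFalse: "eval e s = NIL \<Longrightarrow> exp_cost e s \<le> j \<Longrightarrow> runs (While e c) s j s"
  unfolding runs_def by (fastforce dest: exec.WhileFalse)

text \<open>The inequality is strict so that \<open>z\<close> absorbs the unit that
  \<open>exp_cost\<close> adds to each size and the cell that \<open>CONS\<close> adds to the sizes
  of its arguments. It also forces \<open>0 < z\<close>.\<close>

definition fits :: "nat \<Rightarrow> store \<Rightarrow> bool" where
  "fits z s \<longleftrightarrow> (\<forall>x. size (s x) < z)"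

lemma fits_upd [simp]: "fits z s \<Longrightarrow> size v < z \<Longrightarrow> fits z (s(x := v))"
  by (simp add: fits_def)

lemma fitsD: "fits z s \<Longrightarrow> size (s x) < z"
  by (simp add: fits_def)

fun exp_growth :: "exp \<Rightarrow> nat" where
  "exp_growth (Var x) = 1"
| "exp_growth Nil_exp = 1"
| "exp_growth (Cons_exp e f) = exp_growth e + exp_growth f"
| "exp_growth (Hd e) = exp_growth e"
| "exp_growth (Tl e) = exp_growth e"

fun exp_weight :: "exp \<Rightarrow> nat" where
  "exp_weight (Var x) = 1"
| "exp_weight Nil_exp = 1"
| "exp_weight (Cons_exp e f) = exp_growth e + exp_growth f + exp_weight e + exp_weight f"
| "exp_weight (Hd e) = exp_growth e + exp_weight e"
| "exp_weight (Tl e) = exp_growth e + exp_weight e"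

lemma size_hd_data: "size (hd_data v) \<le> size v"
  by (cases v) auto

lemma size_tl_data: "size (tl_data v) \<le> size v"
  by (cases v) auto

lemma size_eval_less:
  assumes "fits z s"
  shows "size (eval e s) < exp_growth e * z"
proof (induction e)
  case Nil_exp
  then show ?case using fitsD [OF assms, of 0] by simp
next
  case (Hd e)
  then show ?case using size_hd_data le_less_trans by (simp, blast)
next
  case (Tl e)
  then show ?case using size_tl_data le_less_trans by (simp, blast)
qed (use assms in \<open>auto simp: fits_def add_mult_distrib\<close>)

lemma exp_cost_le:
  assumes "fits z s"
  shows "exp_cost e s \<le> exp_weight e * z"
proof (induction e)
  case (Var x)
  then show ?case using fitsD [OF assms, of x] by simp
next
  case Nil_exp
  then show ?case using fitsD [OF assms, of 0] by simp
next
  case (Cons_exp e f)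
  then show ?case
    using size_eval_less [OF assms, of e] size_eval_less [OF assms, of f]
    by (simp add: add_mult_distrib)
next
  case (Hd e)
  then show ?case
    using size_eval_less [OF assms, of "Hd e"] by (simp add: add_mult_distrib)
next
  case (Tl e)
  then show ?case
    using size_eval_less [OF assms, of "Tl e"] by (simp add: add_mult_distrib)
qed

text \<open>For commands without loops and outputs, the cost is linear in the bound \<open>z\<close> on the entries of
  the store, with a constant that depends on the command only. Hence their cost need not be computed.\<close>

fun straight :: "com \<Rightarrow> bool" where
  "straight (Seq c d) \<longleftrightarrow> straight c \<and> straight d"
| "straight (If e c d) \<longleftrightarrow> straight c \<and> straight d"
| "straight (While e c) \<longleftrightarrow> False"
| "straight (Emit e) \<longleftrightarrow> False"
| "straight _ \<longleftrightarrow> True"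

fun effect :: "com \<Rightarrow> store \<Rightarrow> store" where
  "effect (Assign x e) s = s(x := eval e s)"
| "effect (Seq c d) s = effect d (effect c s)"
| "effect (If e c d) s = (if eval e s \<noteq> NIL then effect c s else effect d s)"
| "effect _ s = s"

text \<open>The factor by which the bound on the entries may rise. Sums stand in for maxima, as an
  assignment leaves the other entries in place; a sequence multiplies, because its second part
  starts from the enlarged bound. The same factor enters \<open>weight\<close>.\<close>

fun growth :: "com \<Rightarrow> nat" where
  "growth (Assign x e) = 1 + exp_growth e"
| "growth (Seq c d) = growth c * growth d"
| "growth (If e c d) = growth c + growth d"
| "growth _ = 1"

fun weight :: "com \<Rightarrow> nat" where
  "weight (Assign x e) = exp_weight e"
| "weight (Seq c d) = weight c + weight d * growth c"
| "weight (If e c d) = exp_weight e + weight c + weight d"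
| "weight _ = 1"

lemma fits_mono: "fits z s \<Longrightarrow> z \<le> z' \<Longrightarrow> fits z' s"
  unfolding fits_def using less_le_trans by blast

lemma fits_effect: "fits z s \<Longrightarrow> fits (growth c * z) (effect c s)"
proof (induction c arbitrary: z s)
  case (Assign x e)
  then show ?case
    using size_eval_less [OF Assign, of e] fitsD [OF Assign]
    by (auto simp: fits_def add_mult_distrib intro: trans_less_add1)
next
  case (Seq c d)
  from Seq.IH(2) [OF Seq.IH(1) [OF Seq.prems]] show ?case
    by (simp add: mult.assoc mult.left_commute)
next
  case (If e c d)
  then show ?case
    using fits_mono [OF If.IH(1) [OF If.prems], of "growth (If e c d) * z"]
      fits_mono [OF If.IH(2) [OF If.prems], of "growth (If e c d) * z"]
    by (simp add: add_mult_distrib)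
qed auto

lemma runs_effect:
  "straight c \<Longrightarrow> fits z s \<Longrightarrow> runs c s (weight c * z) (effect c s)"
proof (induction c arbitrary: z s)
  case Skip
  moreover from Skip have "1 \<le> z"
    using fitsD [of z s 0] by simp
  ultimately show ?case
    unfolding runs_def using exec.Skip [of s] by (intro exI [of _ "[Event 1 None s]"]) simp
next
  case (Assign x e)
  let ?t = "s(x := eval e s)"
  show ?case
    unfolding runs_def using exp_cost_le [OF Assign(2), of e]
    by (intro exI [of _ "[Event (exp_cost e s) None ?t]"]) (simp add: exec.Assign)
next
  case (Seq c d)
  have "runs (Seq c d) s (weight c * z + weight d * (growth c * z)) (effect d (effect c s))"
    using Seq fits_effect by (intro runs_Seq) auto
  then show ?case
    by (simp add: algebra_simps)
next
  case (If e c d)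
  show ?case
  proof (cases "eval e s = NIL")
    case True
    with If have "runs (If e c d) s (exp_weight e * z + weight d * z) (effect d s)"
      by (intro runs_IfFalse exp_cost_le) auto
    with True show ?thesis
      by (auto elim!: runs_mono simp: algebra_simps)
  next
    case False
    with If have "runs (If e c d) s (exp_weight e * z + weight c * z) (effect c s)"
      by (intro runs_IfTrue exp_cost_le) auto
    with False show ?thesis
      by (auto elim!: runs_mono simp: algebra_simps)
  qed
qed auto

text \<open>All loops of the program except the outermost consume a list held in one variable, one
  entry per round. \<open>st ys a\<close> is the store with remaining list \<open>ys\<close> and
  accumulator \<open>a\<close>, and \<open>Q\<close> is the invariant that keeps this store
  small.\<close>

lemma runs_While_fold:
  assumes step: "\<And>y ys a. Q (y # ys) a \<Longrightarrow>
      st (y # ys) a x \<noteq> NIL \<and> runs c (st (y # ys) a) k (st ys (g y a)) \<and> Q ys (g y a)"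
    and stop: "\<And>a. Q [] a \<Longrightarrow> st [] a x = NIL"
    and fits: "\<And>ys a. Q ys a \<Longrightarrow> fits z (st ys a)"
    and "Q xs a" and len: "length xs < z" and "s = st xs a" and "t = st [] (fold g xs a)"
  shows "runs (While (Var x) c) s (z * (k + z)) t"
proof -
  have cost: "exp_cost (Var x) (st ys a) \<le> z" if "Q ys a" for ys a
    using fitsD [OF fits [OF that], of x] by simp
  have "runs (While (Var x) c) (st xs a) (length xs * (k + z) + z) (st [] (fold g xs a))"
    using \<open>Q xs a\<close>
  proof (induction xs arbitrary: a)
    case Nil
    with stop [OF Nil] cost [OF Nil] show ?case by (simp add: runs_WhileFalse)
  next
    case (Cons y ys)
    have "runs (While (Var x) c) (st (y # ys) a) (z + k + (length ys * (k + z) + z))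
        (st [] (fold g ys (g y a)))"
      using step [OF Cons.prems] cost [OF Cons.prems] Cons.IH
      by (intro runs_WhileTrue [where t = "st ys (g y a)"]) auto
    then show ?case
      by (simp add: algebra_simps)
  qed
  \<comment> \<open>The successor accounts for the test that ends the loop;
    \<open>length xs < z\<close> is strict to leave room for it.\<close>
  moreover have "Suc (length xs) * (k + z) \<le> z * (k + z)"
    using len by (intro mult_le_mono1) simp
  then have "length xs * (k + z) + z \<le> z * (k + z)"
    by simp
  ultimately show ?thesis
    using runs_mono assms(6,7) by blast
qed

text \<open>This is a bound on the cost of a command if the store fits \<open>z\<close> before and after each straight
  block and each round of a loop, and no loop takes \<open>z\<close> rounds.\<close>

fun time :: "com \<Rightarrow> nat \<Rightarrow> nat" where
  "time (Seq c d) z =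
    (if straight (Seq c d) then weight (Seq c d) * z else time c z + time d z)"
| "time (If e c d) z =
    (if straight (If e c d) then weight (If e c d) * z else exp_weight e * z + time c z + time d z)"
| "time (While e c) z = z * (time c z + exp_weight e * z)"
| "time c z = weight c * z"

definition timed :: "nat \<Rightarrow> com \<Rightarrow> store \<Rightarrow> store \<Rightarrow> bool" where
  "timed z c s t \<longleftrightarrow> runs c s (time c z) t"

lemma time_straight: "straight c \<Longrightarrow> time c z = weight c * z"
  by (cases c) auto

lemma timed_straight: "straight c \<Longrightarrow> fits z s \<Longrightarrow> effect c s = t \<Longrightarrow> timed z c s t"
  unfolding timed_def using runs_effect time_straight by metis

lemma growth_pos: "0 < growth c"
  by (induction c) auto

text \<open>If the sequence is straight as a whole, its \<open>time\<close> charges \<open>d\<close>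
  at the bound \<open>growth c * z\<close>, which is no less than \<open>z\<close> because
  \<open>growth c\<close> is positive. Straight commands can thus also be analysed piece by
  piece.\<close>

lemma timed_Seq:
  assumes "timed z c s t" "timed z d t u"
  shows "timed z (Seq c d) s u"
proof -
  have "weight d * z * 1 \<le> weight d * z * growth c"
    using growth_pos [of c] by (intro mult_le_mono2) simp
  then have "time c z + time d z \<le> time (Seq c d) z"
    by (simp add: time_straight algebra_simps)
  then show ?thesis
    using assms runs_Seq runs_mono unfolding timed_def by blast
qed

lemma timed_If:
  assumes "fits z s" "eval e s \<noteq> NIL \<Longrightarrow> timed z c s t" "eval e s = NIL \<Longrightarrow> timed z d s t"
  shows "timed z (If e c d) s t"
proof (cases "eval e s = NIL")
  case True
  have "exp_weight e * z + time d z \<le> time (If e c d) z"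
    by (simp add: time_straight algebra_simps)
  with True assms show ?thesis
    using runs_IfFalse [OF _ _ exp_cost_le] runs_mono unfolding timed_def by blast
next
  case False
  have "exp_weight e * z + time c z \<le> time (If e c d) z"
    by (simp add: time_straight algebra_simps)
  with False assms show ?thesis
    using runs_IfTrue [OF _ _ exp_cost_le] runs_mono unfolding timed_def by blast
qed

lemma timed_While_fold:
  assumes "Q xs a" "length xs < z" "s = st xs a" "t = st [] (fold g xs a)"
    and step: "\<And>y ys a. Q (y # ys) a \<Longrightarrow> st (y # ys) a x \<noteq> NIL"
      "\<And>y ys a. Q (y # ys) a \<Longrightarrow> timed z c (st (y # ys) a) (st ys (g y a))"
      "\<And>y ys a. Q (y # ys) a \<Longrightarrow> Q ys (g y a)"
    and stop: "\<And>a. Q [] a \<Longrightarrow> st [] a x = NIL"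
    and fits: "\<And>ys a. Q ys a \<Longrightarrow> fits z (st ys a)"
  shows "timed z (While (Var x) c) s t"
  using runs_While_fold [where Q = Q and st = st and g = g and k = "time c z", OF _ stop fits assms(1-4)] step
  by (simp add: timed_def)


section \<open>Echelon bases over the two-element field\<close>

declare add_bit_eq_xor [simp del]

lemma bit_add_self [simp]: "a + a = (0::bit)" "a + (a + b) = (b::bit)"
  by (cases a; simp flip: add.assoc)+

text \<open>Truncation to the shorter list keeps commutativity and associativity free of length
  conditions; cancellation requires equal lengths.\<close>

definition vxor :: "bit list \<Rightarrow> bit list \<Rightarrow> bit list" where
  "vxor u v = map2 (+) u v"

lemma vxor_simps [simp]:
  "vxor [] v = []"
  "vxor u [] = []"
  "vxor (a # u) (b # v) = (a + b) # vxor u v"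
  by (simp_all add: vxor_def)

lemma length_vxor [simp]: "length (vxor u v) = min (length u) (length v)"
  by (simp add: vxor_def)

lemma vxor_commute: "vxor u v = vxor v u"
  by (induction u v rule: list_induct2') (auto simp: add.commute)

lemma vxor_assoc: "vxor (vxor u v) w = vxor u (vxor v w)"
proof (induction u arbitrary: v w)
  case (Cons a u)
  show ?case
    by (cases v; cases w) (auto simp: Cons add.assoc)
qed simp

lemma vxor_cancel [simp]: "length u = length v \<Longrightarrow> vxor u (vxor u v) = v"
  by (induction u v rule: list_induct2) (auto simp flip: add.assoc)

lemma vxor_cancel_right [simp]: "length u = length v \<Longrightarrow> vxor (vxor v u) u = v"
  by (metis vxor_cancel vxor_commute)

text \<open>The entry at position \<open>i\<close> of a basis is \<open>[]\<close> or the part from position \<open>i\<close> on of a basis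
  vector with leading position \<open>i\<close>.\<close>

fun echelon :: "bit list list \<Rightarrow> bool" where
  "echelon [] \<longleftrightarrow> True"
| "echelon (s # S) \<longleftrightarrow> (s = [] \<or> hd s = 1 \<and> length s = Suc (length S)) \<and> echelon S"

text \<open>The first digit varies fastest, so that the list is in the order of a counter whose
  least significant digit comes first.\<close>

fun enum_span :: "bit list list \<Rightarrow> bit list list" where
  "enum_span [] = [[]]"
| "enum_span (s # S) =
    (if s = [] then map ((#) 0) (enum_span S)
     else concat (map (\<lambda>u. [0 # u, 1 # vxor (tl s) u]) (enum_span S)))"

abbreviation span_of :: "bit list list \<Rightarrow> bit list set" where
  "span_of S \<equiv> set (enum_span S)"

lemma span_Cons:
  "span_of (s # S) = (#) 0 ` span_of S \<union> (if s = [] then {} else (\<lambda>u. 1 # vxor (tl s) u) ` span_of S)"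
  by auto

lemma length_span: "echelon S \<Longrightarrow> u \<in> span_of S \<Longrightarrow> length u = length S"
  by (induction S arbitrary: u) (auto split: if_splits)

lemma hd_enum_span: "enum_span S \<noteq> [] \<and> hd (enum_span S) = replicate (length S) 0"
proof (induction S)
  case (Cons s S)
  then show ?case by (cases "enum_span S") auto
qed simp

text \<open>The leading entry separates the two elements built from one \<open>u\<close>, and adding
  \<open>tl s\<close> is injective on vectors of its length.\<close>

lemma distinct_enum_span: "echelon S \<Longrightarrow> distinct (enum_span S)"
proof (induction S)
  case (Cons s S)
  have "distinct (concat (map (\<lambda>u. [0 # u, 1 # vxor (tl s) u]) us))"
    if "distinct us" "\<And>u. u \<in> set us \<Longrightarrow> length u = length (tl s)" for us
    using that
  proof (induction us)
    case (Cons u us)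
    have "vxor (tl s) u \<noteq> vxor (tl s) u'" if "u' \<in> set us" for u'
      using that Cons.prems by (metis distinct.simps(2) list.set_intros vxor_cancel)
    with Cons show ?case by auto
  qed simp
  from this [of "enum_span S"] Cons show ?case
    using length_span [of S] by (auto simp: distinct_map)
qed simp

text \<open>Rows already present cancel the leading 1s of the vector until a 1 falls on a free
  position, where the rest of the vector becomes a new row. A vector of the span is reduced to zero
  and leaves the basis as it is.\<close>

fun insert_vec :: "bit list \<Rightarrow> bit list list \<Rightarrow> bit list list" where
  "insert_vec (a # v) (s # S) =
    (if a = 0 then s # insert_vec v S
     else if s = [] then (a # v) # S
     else s # insert_vec (vxor v (tl s)) S)"
| "insert_vec _ S = S"

lemma length_insert_vec [simp]: "length (insert_vec v S) = length S"
  by (induction v S rule: insert_vec.induct) auto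

lemma echelon_insert_vec: "length v = length S \<Longrightarrow> echelon S \<Longrightarrow> echelon (insert_vec v S)"
  by (induction v S rule: insert_vec.induct) auto

lemma vxor_Cons_image: "vxor (a # v) ` (#) b ` U = (#) (a + b) ` vxor v ` U"
  by (auto simp: image_image)

lemma span_insert_vec:
  "length v = length S \<Longrightarrow> echelon S \<Longrightarrow> span_of (insert_vec v S) = span_of S \<union> vxor v ` span_of S"
proof (induction v S rule: insert_vec.induct)
  case (1 a v s S)
  let ?U = "span_of S" and ?w = "tl s"
  have len: "length v = length S"
    using 1 by simp
  show ?case
  proof (cases "a = 0")
    case a: True
    have "vxor v (vxor ?w u) = vxor ?w (vxor v u)" for u
      by (metis vxor_assoc vxor_commute)
    with a 1 show ?thesis
      by (simp add: span_Cons image_Un image_image del: enum_span.simps) blast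
  next
    case a: False
    show ?thesis
    proof (cases "s = []")
      case True
      with a show ?thesis
        by (simp add: span_Cons image_image del: enum_span.simps)
    next
      case False
      with 1 have lenw: "length ?w = length S"
        by simp
      have IH: "span_of (insert_vec (vxor v ?w) S) = ?U \<union> vxor (vxor v ?w) ` ?U"
        using a False 1 lenw by (intro 1) auto
      have "vxor ?w (vxor (vxor v ?w) u) = vxor v u" if "u \<in> ?U" for u
        using that lenw length_span [of S u] 1 len
        by (metis length_vxor min.idem vxor_assoc vxor_cancel vxor_commute)
      then have "(\<lambda>u. 1 # vxor ?w u) ` vxor (vxor v ?w) ` ?U = (#) 1 ` vxor v ` ?U"
        by (auto simp: image_image)
      \<comment> \<open>The elements with leading 0 are extended by \<open>v + w + u\<close>; these
        come from adding \<open>1 # v\<close> to \<open>1 # (w + u)\<close>.\<close>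
      moreover have "vxor (1 # v) ` (\<lambda>u. 1 # vxor ?w u) ` ?U = (#) 0 ` vxor (vxor v ?w) ` ?U"
        by (auto simp: image_image vxor_assoc)
      ultimately show ?thesis
        using a False IH
        by (simp add: span_Cons image_Un vxor_Cons_image del: enum_span.simps) blast
    qed
  qed
qed auto

text \<open>A binary counter whose least significant digit is the first one. Flipping a digit adds the
  basis vector to the rest of the list; the second flip of the digit undoes this before the carry is
  passed on, so that the rest of the list is incremented in effect.\<close>

fun next_vec :: "bool \<Rightarrow> bit list \<Rightarrow> bit list list \<Rightarrow> bit list \<times> bool" where
  "next_vec c (a # v) (s # S) =
    (if c \<and> s \<noteq> [] then apfst ((#) (a + 1)) (next_vec (a = 1) (vxor v (tl s)) S)
     else apfst ((#) a) (next_vec c v S))"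
| "next_vec c _ _ = ([], c)"

lemma next_vec_no_carry: "length v = length S \<Longrightarrow> next_vec False v S = (v, False)"
  by (induction v S rule: list_induct2) auto

lemma length_next_vec:
  "length v = length S \<Longrightarrow> echelon S \<Longrightarrow> length (fst (next_vec c v S)) = length S"
  by (induction c v S rule: next_vec.induct) auto

text \<open>The last element has to overflow: the outgoing carry is the only sign by which the
  machine recognises the end of the enumeration.\<close>

fun next_path :: "bit list list \<Rightarrow> bit list list \<Rightarrow> bool" where
  "next_path S [] \<longleftrightarrow> False"
| "next_path S [u] \<longleftrightarrow> snd (next_vec True u S)"
| "next_path S (u # v # us) \<longleftrightarrow> next_vec True u S = (v, False) \<and> next_path S (v # us)"

text \<open>For \<open>s \<noteq> []\<close> each \<open>u\<close> yields the pair
  \<open>0 # u\<close>, \<open>1 # vxor (tl s) u\<close>. Incrementing the former flips its digit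
  and stops. Incrementing the latter removes \<open>tl s\<close> again and carries into
  \<open>u\<close> itself, whose successor in \<open>S\<close> begins the next pair. For
  \<open>s = []\<close> the carry passes the digit by.\<close>

lemma next_path_enum_span: "echelon S \<Longrightarrow> next_path S (enum_span S)"
proof (induction S)
  case (Cons s S)
  then have "next_path S (enum_span S)" "\<And>u. u \<in> span_of S \<Longrightarrow> length u = length S"
    using length_span by auto
  then show ?case
  proof (cases "s = []")
    case True
    have "next_path (s # S) (map ((#) 0) us)" if "next_path S us" for us
      using that by (induction S us rule: next_path.induct) (auto simp: True)
    with True \<open>next_path S (enum_span S)\<close> show ?thesis by simp
  next
    case False
    with Cons have w: "length (tl s) = length S"
      by simp
    have "next_path (s # S) (concat (map (\<lambda>u. [0 # u, 1 # vxor (tl s) u]) us))"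
      if "next_path S us" "\<And>u. u \<in> set us \<Longrightarrow> length u = length S" for us
      using that w
      by (induction S us rule: next_path.induct)
        (auto simp: False next_vec_no_carry vxor_commute [of "tl s"])
    with False \<open>next_path S (enum_span S)\<close> \<open>\<And>u. u \<in> span_of S \<Longrightarrow> length u = length S\<close>
    show ?thesis by simp
  qed
qed simp


section \<open>Signatures as an affine space\<close>

text \<open>Vectors list the clauses in reverse order, which is the order in which the machine builds them.\<close>

definition lin :: "xor_cnf \<Rightarrow> (nat \<Rightarrow> bit) \<Rightarrow> bit list" where
  "lin \<phi> a = rev (map (\<lambda>C. \<Sum>i\<leftarrow>fst C. a i) \<phi>)"

definition column :: "xor_cnf \<Rightarrow> nat \<Rightarrow> bit list" where
  "column \<phi> x = lin \<phi> (\<lambda>i. of_bool (i = x))"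

text \<open>Over two elements, \<open>x = e\<close> has the truth value \<open>x + (e + 1)\<close>.
  So the offset is the signature, in reverse, of the zero assignment.\<close>

definition offset :: "xor_cnf \<Rightarrow> bit list" where
  "offset \<phi> = rev (map (\<lambda>C. snd C + 1) \<phi>)"

lemma length_lin [simp]: "length (lin \<phi> a) = length \<phi>"
  by (simp add: lin_def)

lemma length_column [simp]: "length (column \<phi> x) = length \<phi>"
  by (simp add: column_def)

lemma length_offset [simp]: "length (offset \<phi>) = length \<phi>"
  by (simp add: offset_def)

lemma vxor_rev: "length u = length v \<Longrightarrow> vxor (rev u) (rev v) = rev (vxor u v)"
  by (simp add: vxor_def zip_rev rev_map)

lemma vxor_map: "vxor (map f xs) (map g xs) = map (\<lambda>x. f x + g x) xs"
  by (induction xs) auto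

lemma vxor_lin: "vxor (lin \<phi> a) (lin \<phi> b) = lin \<phi> (\<lambda>i. a i + b i)"
  by (simp add: lin_def vxor_rev vxor_map sum_list_addf)

lemma signature_eq_vxor: "signature \<phi> a = rev (vxor (lin \<phi> a) (offset \<phi>))"
proof -
  have "clause_value C a = (\<Sum>i\<leftarrow>fst C. a i) + (snd C + 1)" for C
    unfolding clause_value_def clause_holds_def
    by (cases "\<Sum>i\<leftarrow>fst C. a i"; cases "snd C") auto
  then show ?thesis
    by (simp add: signature_def lin_def offset_def vxor_rev vxor_map)
qed

definition lin_on :: "xor_cnf \<Rightarrow> nat set \<Rightarrow> bit list set" where
  "lin_on \<phi> X = lin \<phi> ` {a. \<forall>i. i \<notin> X \<longrightarrow> a i = 0}"

lemma lin_on_empty: "lin_on \<phi> {} = {replicate (length \<phi>) 0}"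
proof -
  have "{a. \<forall>i. a i = 0} = {\<lambda>i::nat. 0::bit}" by auto
  then show ?thesis
    by (simp add: lin_on_def lin_def map_replicate_const sum_list_replicate)
qed

text \<open>An assignment with value 1 at \<open>x\<close> is the indicator of \<open>x\<close> plus
  one that vanishes at \<open>x\<close>. The right-hand side has the shape of
  \<open>span_insert_vec\<close>, so inserting a column amounts to freeing one more
  variable.\<close>

lemma lin_on_insert: "lin_on \<phi> (insert x X) = lin_on \<phi> X \<union> vxor (column \<phi> x) ` lin_on \<phi> X"
proof (intro equalityI subsetI)
  fix v
  assume "v \<in> lin_on \<phi> (insert x X)"
  then obtain a where a: "\<And>i. i \<notin> insert x X \<Longrightarrow> a i = 0" "v = lin \<phi> a"
    by (auto simp: lin_on_def)
  show "v \<in> lin_on \<phi> X \<union> vxor (column \<phi> x) ` lin_on \<phi> X"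
  proof (cases "a x = 0")
    case True
    with a have "a i = 0" if "i \<notin> X" for i
      using that by (cases "i = x") auto
    with a have "v \<in> lin_on \<phi> X"
      by (auto simp: lin_on_def)
    then show ?thesis ..
  next
    case False
    have "v = vxor (column \<phi> x) (lin \<phi> (a(x := 0)))"
      unfolding column_def vxor_lin a(2) using False by (intro arg_cong [of _ _ "lin \<phi>"]) auto
    moreover have "lin \<phi> (a(x := 0)) \<in> lin_on \<phi> X"
      using a by (auto simp: lin_on_def)
    ultimately show ?thesis by blast
  qed
next
  fix v
  assume "v \<in> lin_on \<phi> X \<union> vxor (column \<phi> x) ` lin_on \<phi> X"
  then show "v \<in> lin_on \<phi> (insert x X)"
    by (auto simp: lin_on_def column_def vxor_lin)
qed

definition occurrences :: "xor_cnf \<Rightarrow> nat list" where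
  "occurrences \<phi> = concat (map fst \<phi>)"

definition sig_basis :: "xor_cnf \<Rightarrow> bit list list" where
  "sig_basis \<phi> = fold (\<lambda>x. insert_vec (column \<phi> x)) (occurrences \<phi>) (replicate (length \<phi>) [])"

lemma fold_insert_vec_invariant:
  assumes "echelon S" "length S = length \<phi>" "span_of S = lin_on \<phi> X"
    and "S' = fold (\<lambda>x. insert_vec (column \<phi> x)) xs S"
  shows "echelon S' \<and> length S' = length \<phi> \<and> span_of S' = lin_on \<phi> (set xs \<union> X)"
  using assms
proof (induction xs arbitrary: S X)
  case (Cons x xs)
  let ?S = "insert_vec (column \<phi> x) S"
  have "span_of ?S = lin_on \<phi> (insert x X)"
    using Cons.prems by (simp add: span_insert_vec lin_on_insert)
  then show ?case
    using Cons.IH [of ?S "insert x X"] Cons.prems by (simp add: echelon_insert_vec)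
qed simp

lemma sig_basis: "echelon (sig_basis \<phi>)" "length (sig_basis \<phi>) = length \<phi>" "span_of (sig_basis \<phi>) = range (lin \<phi>)"
proof -
  have "echelon (replicate n [])" "enum_span (replicate n []) = [replicate n 0]" for n
    by (induction n) auto
  then have *: "echelon (sig_basis \<phi>) \<and> length (sig_basis \<phi>) = length \<phi> \<and>
      span_of (sig_basis \<phi>) = lin_on \<phi> (set (occurrences \<phi>) \<union> {})"
    by (intro fold_insert_vec_invariant) (auto simp: lin_on_empty sig_basis_def)
  then show "echelon (sig_basis \<phi>)" "length (sig_basis \<phi>) = length \<phi>"
    by auto
  \<comment> \<open>Values of variables that do not occur may be reset to 0, which brings every
    assignment into the support set of \<open>lin_on\<close>.\<close>
  have "lin \<phi> a = lin \<phi> (\<lambda>i. if i \<in> set (occurrences \<phi>) then a i else 0)" for a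
    unfolding lin_def occurrences_def
    by (intro arg_cong [of _ _ rev] map_cong refl arg_cong [of _ _ sum_list]) auto
  then have "range (lin \<phi>) \<subseteq> lin_on \<phi> (set (occurrences \<phi>))"
    unfolding lin_on_def by fastforce
  with * show "span_of (sig_basis \<phi>) = range (lin \<phi>)"
    by (auto simp: lin_on_def)
qed

definition output_vec :: "xor_cnf \<Rightarrow> bit list \<Rightarrow> bit list" where
  "output_vec \<phi> u = rev (vxor u (offset \<phi>))"

lemma signatures_eq_span: "signatures \<phi> = output_vec \<phi> ` span_of (sig_basis \<phi>)"
  by (auto simp: signatures_def sig_basis output_vec_def signature_eq_vxor)

lemma distinct_outputs: "distinct (map (output_vec \<phi>) (enum_span (sig_basis \<phi>)))"
proof -
  have "inj_on (output_vec \<phi>) (span_of (sig_basis \<phi>))"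
  proof (rule inj_onI)
    fix u v
    assume "u \<in> span_of (sig_basis \<phi>)" "v \<in> span_of (sig_basis \<phi>)"
      and eq: "output_vec \<phi> u = output_vec \<phi> v"
    then have "length u = length \<phi>" "length v = length \<phi>"
      using length_span [OF sig_basis(1)] by (auto simp: sig_basis)
    \<comment> \<open>Adding the offset a second time recovers the element of the span.\<close>
    moreover from eq have "vxor (vxor u (offset \<phi>)) (offset \<phi>) = vxor (vxor v (offset \<phi>)) (offset \<phi>)"
      by (simp add: output_vec_def)
    ultimately show "u = v"
      by simp
  qed
  then show ?thesis
    by (simp add: distinct_map distinct_enum_span sig_basis)
qed


section \<open>The program\<close>

abbreviation enc_vec :: "bit list \<Rightarrow> data" where
  "enc_vec \<equiv> enc_list enc_bit"

abbreviation enc_mat :: "bit list list \<Rightarrow> data" where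
  "enc_mat \<equiv> enc_list enc_vec"

lemma enc_bit_simps [simp]:
  "enc_bit 0 = NIL"
  "enc_bit 1 = CONS NIL NIL"
  "enc_bit b = NIL \<longleftrightarrow> b = 0"
  by (auto simp: enc_bit_def)

lemma enc_list_eq_NIL [simp]: "enc_list f xs = NIL \<longleftrightarrow> xs = []"
  by (cases xs) auto

lemma tl_enc_list [simp]: "tl_data (enc_list f xs) = enc_list f (tl xs)"
  by (cases xs) auto

lemma length_le_size_enc_list: "length xs \<le> size (enc_list f xs)"
  by (simp add: size_enc_list)

lemma size_enc_vec: "size (enc_vec v) \<le> 2 * length v"
  by (induction v) (use size_enc_bit in \<open>auto intro: order_trans [OF add_mono]\<close>)

lemma size_enc_vec_less: "2 * length v < z \<Longrightarrow> size (enc_vec v) < z"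
  using size_enc_vec [of v] by linarith

lemma size_enc_mat:
  "\<forall>r\<in>set S. length r \<le> m \<Longrightarrow> size (enc_mat S) \<le> length S * (2 * m + 1)"
proof (induction S)
  case (Cons r S)
  then show ?case using size_enc_vec [of r] by auto
qed simp

text \<open>A matrix of \<open>m\<close> rows with at most \<open>m\<close> bits takes one cell per
  row and at most two per bit, hence \<open>m * (2 * m + 1)\<close>. The condition
  \<open>1 < z\<close> leaves room for an encoded bit 1.\<close>

definition room :: "nat \<Rightarrow> nat \<Rightarrow> bool" where
  "room m z \<longleftrightarrow> 1 < z \<and> m * (2 * m + 1) < z"

lemma room_size_vec: "room m z \<Longrightarrow> length v \<le> m \<Longrightarrow> size (enc_vec v) < z"
proof -
  assume "room m z" "length v \<le> m"
  moreover have "2 * m \<le> m * (2 * m + 1)"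
    by (cases m) auto
  ultimately show ?thesis
    unfolding room_def by (intro size_enc_vec_less) linarith
qed

lemma room_size_mat:
  assumes "room m z" "\<forall>r\<in>set S. length r \<le> m" "length S \<le> m"
  shows "size (enc_mat S) < z"
proof -
  have "length S * (2 * m + 1) \<le> m * (2 * m + 1)"
    using assms(3) by (rule mult_le_mono1)
  with size_enc_mat [OF assms(2)] assms(1) show ?thesis
    unfolding room_def by linarith
qed

text \<open>The use of the variables:
  0 the formula,
  1 its clauses still to be processed, 2 the variables of the current clause still to be processed,
  3 and 4 the same while a column is computed,
  5 and 6 the indices to be compared, 7 whether they differ, 8 the parity of the number of
  occurrences,
  9 the echelon basis, 10 the current vector, 11 a vector to be added to it, 12 the reversed sum,
  13 the part of the basis still to be processed, 14 the reversed result for the processed part,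
  15 the offset, 16 the loop condition and carry, 17 the current element of the span.\<close>

abbreviation "true_exp \<equiv> Cons_exp Nil_exp Nil_exp"

section \<open>Stack operations on encoded lists\<close>

definition push :: "nat \<Rightarrow> exp \<Rightarrow> com" where
  "push x e = Assign x (Cons_exp e (Var x))"

lemma push_simps [simp]:
  "straight (push x e)"
  "effect (push x e) s = s(x := CONS (eval e s) (s x))"
  by (simp_all add: push_def)

definition pop :: "nat \<Rightarrow> com" where
  "pop x = Assign x (Tl (Var x))"

lemma pop_simps [simp]:
  "straight (pop x)"
  "effect (pop x) s = s(x := tl_data (s x))"
  by (simp_all add: pop_def)

definition move :: "nat \<Rightarrow> nat \<Rightarrow> com" where
  "move x y = While (Var x) (Seq (push y (Hd (Var x))) (pop x))"

text \<open>Whole trees are moved, so the total size of both lists is invariant and the argument is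
  uniform in the encoding \<open>f\<close> of the entries.\<close>

lemma timed_move:
  assumes "x \<noteq> y" "fits z s" "s x = enc_list f us" "s y = enc_list f vs"
    and "size (enc_list f (us @ vs)) < z"
  shows "timed z (move x y) s (s(x := NIL, y := enc_list f (rev us @ vs)))"
  unfolding move_def
proof (rule timed_While_fold
    [where st = "\<lambda>us vs. s(x := enc_list f us, y := enc_list f vs)" and g = "(#)"
      and Q = "\<lambda>us vs. size (enc_list f (us @ vs)) < z"])
  show "size (enc_list f (us @ vs)) < z" by fact
  show "length us < z"
    using assms(5) by (simp add: size_enc_list)
next
  fix u us vs
  assume "size (enc_list f ((u # us) @ vs)) < z"
  then show "timed z (Seq (push y (Hd (Var x))) (pop x))
      (s(x := enc_list f (u # us), y := enc_list f vs))
      (s(x := enc_list f us, y := enc_list f (u # vs)))"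
    using assms(1,2) by (intro timed_straight fits_upd) (auto simp: fun_eq_iff size_enc_list)
qed (use assms in \<open>auto simp: fun_eq_iff size_enc_list fold_Cons_rev\<close>)

section \<open>Addition of vectors\<close>

definition xor_step :: com where
  "xor_step =
    Seq (If (Hd (Var 10))
          (If (Hd (Var 11)) (push 12 Nil_exp) (push 12 true_exp))
          (push 12 (Hd (Var 11))))
      (Seq (pop 10) (pop 11))"

text \<open>Kept apart from \<open>xor_com\<close> because the reversed sum is itself of use:
  reversal restores the clause order, as an output requires.\<close>

definition xor_push :: com where
  "xor_push = While (Var 10) xor_step"

lemma timed_xor_push:
  assumes "fits z s" "room m z"
    and "s 10 = enc_vec u" "s 11 = enc_vec v" "s 12 = NIL" "length v = length u" "length u \<le> m"
  shows "timed z xor_push s (s(10 := NIL, 11 := NIL, 12 := enc_vec (rev (vxor u v))))"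
proof -
  have *: "fold (\<lambda>(a, b). (#) (a + b)) (zip u v) w = rev (vxor u v) @ w" for w
    using assms(6) by (induction u arbitrary: v w) (auto simp: length_Suc_conv)
  show ?thesis
    unfolding xor_push_def
  proof (rule timed_While_fold
      [where st = "\<lambda>ps w. s(10 := enc_vec (map fst ps), 11 := enc_vec (map snd ps), 12 := enc_vec w)"
        and g = "\<lambda>(a, b). (#) (a + b)" and Q = "\<lambda>ps w. length ps + length w \<le> m"
        and xs = "zip u v" and a = "[]"])
    show "length (zip u v) < z"
      using room_size_vec [OF assms(2,7)] length_le_size_enc_list [of u enc_bit] by simp
  next
    fix p :: "bit \<times> bit" and ps and w :: "bit list"
    assume "length (p # ps) + length w \<le> m"
    then show "timed z xor_step
        (s(10 := enc_vec (map fst (p # ps)), 11 := enc_vec (map snd (p # ps)), 12 := enc_vec w))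
        (s(10 := enc_vec (map fst ps), 11 := enc_vec (map snd ps),
          12 := enc_vec ((case p of (a, b) \<Rightarrow> (#) (a + b)) w)))"
      unfolding xor_step_def
      by (intro timed_straight fits_upd assms room_size_vec [OF assms(2)])
        (auto simp: fun_eq_iff split: prod.splits)
  qed (use assms * in \<open>auto simp: fun_eq_iff intro!: fits_upd room_size_vec [OF assms(2)]\<close>)
qed

definition xor_com :: com where
  "xor_com = Seq xor_push (move 12 10)"

lemma timed_xor_com:
  assumes "fits z s" "room m z"
    and "s 10 = enc_vec u" "s 11 = enc_vec v" "s 12 = NIL" "length v = length u" "length u \<le> m"
  shows "timed z xor_com s (s(10 := enc_vec (vxor u v), 11 := NIL))"
proof -
  let ?s = "s(10 := NIL, 11 := NIL, 12 := enc_vec (rev (vxor u v)))"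
  have sz: "size (enc_vec (rev (vxor u v))) < z"
    using assms by (intro room_size_vec) auto
  have "timed z (move 12 10) ?s (?s(12 := NIL, 10 := enc_vec (rev (rev (vxor u v)) @ [])))"
    using assms(1) sz by (intro timed_move fits_upd) auto
  moreover have "?s(12 := NIL, 10 := enc_vec (rev (rev (vxor u v)) @ []))
      = s(10 := enc_vec (vxor u v), 11 := NIL)"
    using assms by (auto simp: fun_eq_iff)
  ultimately show ?thesis
    unfolding xor_com_def using timed_xor_push [OF assms] by (metis timed_Seq)
qed


section \<open>Insertion of a vector into the basis\<close>

definition insert_head :: com where
  "insert_head =
    If (Hd (Var 10))
      (If (Hd (Var 9))
        (Seq (Seq (push 14 (Hd (Var 9))) (Assign 11 (Hd (Var 9)))) xor_com)
        (Seq (push 14 (Var 10)) (Assign 10 Nil_exp)))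
      (push 14 (Hd (Var 9)))"

definition insert_step :: com where
  "insert_step = Seq insert_head (Seq (pop 10) (pop 9))"

definition insert_com :: com where
  "insert_com = Seq (While (Var 9) insert_step) (move 14 9)"

text \<open>The loop body behind \<open>insert_vec\<close>, with the processed rows reversed in the
  second component. After the vector has been placed it is replaced by \<open>[]\<close>; as the
  head of \<open>NIL\<close> is \<open>NIL\<close>, the machine treats this like an entry 0 and
  copies the remaining rows.\<close>

fun insert_acc :: "bit list \<Rightarrow> bit list \<times> bit list list \<Rightarrow> bit list \<times> bit list list" where
  "insert_acc r ([], A) = ([], r # A)"
| "insert_acc r (a # v, A) =
    (if a = 0 then (v, r # A) else if r = [] then ([], (a # v) # A) else (vxor v (tl r), r # A))"

lemma fold_insert_acc_Nil: "fold insert_acc S ([], A) = ([], rev S @ A)"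
  by (induction S arbitrary: A) auto

lemma fold_insert_acc:
  "length v = length S \<Longrightarrow> echelon S \<Longrightarrow>
    fold insert_acc S (v, A) = ([], rev (insert_vec v S) @ A)"
  by (induction v S arbitrary: A rule: insert_vec.induct) (auto simp: fold_insert_acc_Nil)

lemma timed_insert_step:
  assumes "fits z s" "room m z" "echelon (r # S)" "v = [] \<or> length v = Suc (length S)"
    and "length (r # S) + length A \<le> m" "\<forall>r\<in>set A. length r \<le> m"
    and "s 9 = enc_mat (r # S)" "s 10 = enc_vec v" "s 11 = NIL" "s 12 = NIL" "s 14 = enc_mat A"
    and "insert_acc r (v, A) = (v', A')"
  shows "timed z insert_step s (s(9 := enc_mat S, 10 := enc_vec v', 14 := enc_mat A'))"
proof -
  \<comment> \<open>The content of variable 10 before the pops. The machine adds the whole row, so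
    that a cancelled leading entry is still there as a 0, while \<open>insert_acc\<close> adds
    tails.\<close>
  let ?w = "if v \<noteq> [] \<and> hd v = 1 then if r = [] then [] else vxor v r else v"
  let ?t = "s(10 := enc_vec ?w, 14 := enc_mat A')"
  have len: "length v \<le> m" "length r \<le> m"
    using assms by auto
  have hd10: "hd_data (s 10) = NIL \<longleftrightarrow> v = [] \<or> hd v = 0"
    using assms by (cases v) auto
  have "timed z insert_head s ?t"
    unfolding insert_head_def
  proof (intro timed_If assms)
    assume "eval (Hd (Var 10)) s \<noteq> NIL"
    then obtain a u where v: "v = a # u" "a = 1"
      using hd10 by (cases v) auto
    let ?s = "s(14 := enc_mat (r # A), 11 := enc_vec r)"
    show "timed z (Seq (Seq (push 14 (Hd (Var 9))) (Assign 11 (Hd (Var 9)))) xor_com) s ?t"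
      if "eval (Hd (Var 9)) s \<noteq> NIL"
    proof (rule timed_Seq)
      show "timed z (Seq (push 14 (Hd (Var 9))) (Assign 11 (Hd (Var 9)))) s ?s"
        using assms by (intro timed_straight) auto
      have r: "r \<noteq> []"
        using that assms by auto
      have "timed z xor_com ?s (?s(10 := enc_vec (vxor v r), 11 := NIL))"
        using assms r v len
        by (intro timed_xor_com [where m = m] fits_upd room_size_vec [OF assms(2)]
            room_size_mat [OF assms(2)]) auto
      moreover have "?s(10 := enc_vec (vxor v r), 11 := NIL) = ?t"
        using assms r v by (auto simp: fun_eq_iff)
      ultimately show "timed z xor_com ?s ?t" by simp
    qed
    show "timed z (Seq (push 14 (Var 10)) (Assign 10 Nil_exp)) s ?t"
      if "eval (Hd (Var 9)) s = NIL"
      using assms v that by (intro timed_straight) (auto simp: fun_eq_iff)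
  next
    assume "eval (Hd (Var 10)) s = NIL"
    then have "v = [] \<or> hd v = 0"
      using hd10 by simp
    then show "timed z (push 14 (Hd (Var 9))) s ?t"
      using assms by (intro timed_straight) (cases v; auto simp: fun_eq_iff)+
  qed
  moreover have "timed z (Seq (pop 10) (pop 9)) ?t (s(9 := enc_mat S, 10 := enc_vec v', 14 := enc_mat A'))"
  proof (rule timed_straight)
    have "\<forall>r\<in>set A'. length r \<le> m" "length A' \<le> m"
      using assms len by (cases v; auto split: if_splits)+
    then show "fits z ?t"
      using assms len by (intro fits_upd room_size_vec [OF assms(2)] room_size_mat [OF assms(2)]) auto
    show "effect (Seq (pop 10) (pop 9)) ?t = s(9 := enc_mat S, 10 := enc_vec v', 14 := enc_mat A')"
      using assms by (cases v; cases r) (auto simp: fun_eq_iff split: if_splits)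
  qed simp
  ultimately show ?thesis
    unfolding insert_step_def by (rule timed_Seq)
qed

lemma echelon_length: "echelon S \<Longrightarrow> r \<in> set S \<Longrightarrow> length r \<le> length S"
  by (induction S) auto

text \<open>Each round passes one row from variable 9 to variable 14. Together they hold at most
  \<open>m\<close> rows of length at most \<open>m\<close>, which \<open>room m z\<close>
  covers.\<close>

lemma timed_insert_com:
  assumes "fits z s" "room m z" "echelon S" "length S = m" "length v = m"
    and "s 9 = enc_mat S" "s 10 = enc_vec v" "s 11 = NIL" "s 12 = NIL" "s 14 = NIL"
  shows "timed z insert_com s (s(9 := enc_mat (insert_vec v S), 10 := NIL))"
proof -
  let ?S = "insert_vec v S"
  let ?s = "s(9 := NIL, 10 := NIL, 14 := enc_mat (rev ?S))"
  have szS: "size (enc_mat (rev ?S)) < z"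
    using echelon_length [of ?S] echelon_insert_vec [of v S] assms
    by (intro room_size_mat [OF assms(2)]) auto
  have "timed z (While (Var 9) insert_step) s ?s"
  proof (rule timed_While_fold
      [where st = "\<lambda>S (v, A). s(9 := enc_mat S, 10 := enc_vec v, 14 := enc_mat A)"
        and g = insert_acc and xs = S and a = "(v, [])"
        and Q = "\<lambda>S (v, A). length S + length A \<le> m \<and> echelon S \<and>
          (v = [] \<or> length v = length S) \<and> (\<forall>r\<in>set A. length r \<le> m)"])
    show "length S < z"
      using assms szS length_le_size_enc_list [of "rev ?S" enc_vec] by simp
  next
    fix r S and a :: "bit list \<times> bit list list"
    assume "case a of (v, A) \<Rightarrow> length (r # S) + length A \<le> m \<and> echelon (r # S) \<and>
          (v = [] \<or> length v = length (r # S)) \<and> (\<forall>r\<in>set A. length r \<le> m)"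
    then obtain v A where a: "a = (v, A)" and Q: "length (r # S) + length A \<le> m" "echelon (r # S)"
        "v = [] \<or> length v = Suc (length S)" "\<forall>r\<in>set A. length r \<le> m"
      by auto
    obtain v' A' where acc: "insert_acc r (v, A) = (v', A')"
      by force
    from Q show "case insert_acc r a of (v, A) \<Rightarrow> length S + length A \<le> m \<and> echelon S \<and>
          (v = [] \<or> length v = length S) \<and> (\<forall>r\<in>set A. length r \<le> m)"
      unfolding a by (cases v) (auto split: if_splits)
    let ?s = "s(9 := enc_mat (r # S), 10 := enc_vec v, 14 := enc_mat A)"
    have "\<forall>q\<in>set (r # S). length q \<le> m"
      using Q echelon_length [of "r # S"] by fastforce
    then have "timed z insert_step ?s (?s(9 := enc_mat S, 10 := enc_vec v', 14 := enc_mat A'))"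
      using Q assms acc
      by (intro timed_insert_step [where m = m and v = v and A = A and r = r] fits_upd
          room_size_vec [OF assms(2)] room_size_mat [OF assms(2)]) auto
    moreover have "?s(9 := enc_mat S, 10 := enc_vec v', 14 := enc_mat A')
        = s(9 := enc_mat S, 10 := enc_vec v', 14 := enc_mat A')"
      by (auto simp: fun_eq_iff)
    ultimately show "timed z insert_step
        (case a of (v, A) \<Rightarrow> s(9 := enc_mat (r # S), 10 := enc_vec v, 14 := enc_mat A))
        (case insert_acc r a of (v, A) \<Rightarrow> s(9 := enc_mat S, 10 := enc_vec v, 14 := enc_mat A))"
      unfolding a acc by simp
  next
    fix S and a :: "bit list \<times> bit list list"
    assume "case a of (v, A) \<Rightarrow> length S + length A \<le> m \<and> echelon S \<and>
          (v = [] \<or> length v = length S) \<and> (\<forall>r\<in>set A. length r \<le> m)"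
    then show "fits z (case a of (v, A) \<Rightarrow> s(9 := enc_mat S, 10 := enc_vec v, 14 := enc_mat A))"
      using assms(1) echelon_length [of S]
      by (cases a) (fastforce intro!: fits_upd room_size_vec [OF assms(2)] room_size_mat [OF assms(2)])
  qed (use assms in \<open>auto simp: fun_eq_iff fold_insert_acc\<close>)
  moreover have "timed z (move 14 9) ?s (?s(14 := NIL, 9 := enc_mat (rev (rev ?S) @ [])))"
    using assms szS by (intro timed_move fits_upd) auto
  moreover have "?s(14 := NIL, 9 := enc_mat (rev (rev ?S) @ [])) = s(9 := enc_mat ?S, 10 := NIL)"
    using assms by (auto simp: fun_eq_iff)
  ultimately show ?thesis
    unfolding insert_com_def by (metis timed_Seq)
qed

section \<open>Comparison of indices and parity of occurrences\<close>

definition equal_step :: com where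
  "equal_step =
    Seq (If (Var 6)
          (If (Hd (Var 5))
            (If (Hd (Var 6)) Skip (Assign 7 true_exp))
            (If (Hd (Var 6)) (Assign 7 true_exp) Skip))
          (Assign 7 true_exp))
      (Seq (pop 5) (pop 6))"

definition count_end :: com where
  "count_end =
    Seq (If (Var 6) (Assign 7 true_exp) Skip)
      (Seq (If (Var 7) Skip (If (Var 8) (Assign 8 Nil_exp) (Assign 8 true_exp)))
        (Seq (Assign 6 Nil_exp) (Seq (Assign 7 Nil_exp) (pop 4))))"

definition count_step :: com where
  "count_step =
    Seq (Seq (Assign 5 (Hd (Var 2))) (Assign 6 (Hd (Var 4))))
      (Seq (While (Var 5) equal_step) count_end)"

definition differ_acc :: "bit \<Rightarrow> bit list \<times> bool \<Rightarrow> bit list \<times> bool" where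
  "differ_acc a = (\<lambda>(ys, d). (tl ys, d \<or> ys = [] \<or> hd ys \<noteq> a))"

text \<open>The flag is raised at a differing digit or when \<open>ys\<close> is exhausted early; a
  longer \<open>ys\<close> shows only in the remainder \<open>zs\<close>, which is why
  \<open>count_end\<close> inspects variable 6.\<close>

lemma fold_differ_acc:
  "fold differ_acc xs (ys, d) = (zs, d') \<Longrightarrow> d' \<or> zs \<noteq> [] \<longleftrightarrow> d \<or> xs \<noteq> ys"
proof (induction xs arbitrary: ys d)
  case (Cons x xs)
  then show ?case
    using Cons.IH [of "tl ys"] by (cases ys) (auto simp: differ_acc_def)
qed auto

lemma timed_count_step:
  assumes "fits z s" "1 < z"
    and "s 2 = enc_list enc_nat (x # xs)" "s 4 = enc_list enc_nat (y # ys)" "s 8 = enc_bit p"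
    and "s 5 = NIL" "s 6 = NIL" "s 7 = NIL"
  shows "timed z count_step s (s(4 := enc_list enc_nat ys, 8 := enc_bit (p + of_bool (y = x))))"
proof -
  let ?b = "binary x" and ?c = "binary y"
  \<comment> \<open>The lengths of the indices are not bounded by the number of clauses; the bound
    comes from the lists in the store that contain them.\<close>
  have sz: "size (enc_vec ?b) < z" "size (enc_vec ?c) < z"
    using fitsD [OF assms(1), of 2] fitsD [OF assms(1), of 4] assms(3,4)
    by (auto simp: enc_nat_def)
  let ?s = "s(5 := enc_vec ?b, 6 := enc_vec ?c)"
  obtain zs d where zs: "fold differ_acc ?b (?c, False) = (zs, d)"
    by force
  let ?t = "s(5 := NIL, 6 := enc_vec zs, 7 := enc_bit (of_bool d))"
  have fits: "fits z (s(5 := enc_vec xs, 6 := enc_vec ys, 7 := enc_bit (of_bool d)))"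
    if "size (enc_vec xs) < z" "size (enc_vec ys) < z" for xs ys d
    using that assms by (intro fits_upd) auto
  have tl: "size (enc_vec (tl ys)) < z" if "size (enc_vec ys) < z" for ys
    using that by (cases ys) auto
  have szs: "size (enc_vec (fst (fold differ_acc us (vs, d)))) < z"
    if "size (enc_vec vs) < z" for us vs d
    using that by (induction us arbitrary: vs d) (auto simp: differ_acc_def tl)
  have "timed z (Seq (Assign 5 (Hd (Var 2))) (Assign 6 (Hd (Var 4)))) s ?s"
    using assms by (intro timed_straight) (auto simp: enc_nat_def)
  moreover have "timed z (While (Var 5) equal_step) ?s ?t"
  proof (rule timed_While_fold
      [where st = "\<lambda>xs (ys, d). s(5 := enc_vec xs, 6 := enc_vec ys, 7 := enc_bit (of_bool d))"
        and g = differ_acc and xs = ?b and a = "(?c, False)"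
        and Q = "\<lambda>xs (ys, d). size (enc_vec xs) < z \<and> size (enc_vec ys) < z"])
    show "length ?b < z"
      using sz length_le_size_enc_list [of ?b enc_bit] by simp
  next
    fix a :: bit and xs and c :: "bit list \<times> bool"
    obtain ys d where c: "c = (ys, d)" by force
    assume "case c of (ys, d) \<Rightarrow> size (enc_vec (a # xs)) < z \<and> size (enc_vec ys) < z"
    then have Q: "size (enc_vec (a # xs)) < z" "size (enc_vec ys) < z"
      by (auto simp: c)
    then show "case differ_acc a c of (ys, d) \<Rightarrow> size (enc_vec xs) < z \<and> size (enc_vec ys) < z"
      by (auto simp: c differ_acc_def tl)
    show "timed z equal_step
       (case c of (ys, d) \<Rightarrow> s(5 := enc_vec (a # xs), 6 := enc_vec ys, 7 := enc_bit (of_bool d)))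
       (case differ_acc a c of (ys, d) \<Rightarrow> s(5 := enc_vec xs, 6 := enc_vec ys, 7 := enc_bit (of_bool d)))"
      unfolding c equal_step_def differ_acc_def prod.case using fits [OF Q]
      by (intro timed_straight) (cases ys; auto simp: fun_eq_iff)+
  qed (use assms zs sz fits in \<open>auto simp: fun_eq_iff\<close>)
  moreover have "timed z count_end ?t (s(4 := enc_list enc_nat ys, 8 := enc_bit (p + of_bool (y = x))))"
  proof (rule timed_straight)
    show "fits z ?t"
      using fits [of "[]" zs d] szs [OF sz(2), of ?b False] zs assms(2) by simp
    have "d \<or> zs \<noteq> [] \<longleftrightarrow> y \<noteq> x"
      using fold_differ_acc [OF zs] inj_binary by (auto dest: injD)
    then show "effect count_end ?t = s(4 := enc_list enc_nat ys, 8 := enc_bit (p + of_bool (y = x)))"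
      unfolding count_end_def using assms by (cases "y = x") (auto simp: fun_eq_iff)
  qed (simp add: count_end_def)
  ultimately show ?thesis
    unfolding count_step_def by (blast intro: timed_Seq)
qed


section \<open>Columns of the coefficient matrix\<close>

definition column_step :: com where
  "column_step =
    Seq (Assign 4 (Tl (Hd (Var 3))))
      (Seq (While (Var 4) count_step)
        (Seq (push 10 (Var 8)) (Seq (Assign 8 Nil_exp) (pop 3))))"

definition column_com :: com where
  "column_com = Seq (Assign 3 (Var 0)) (While (Var 3) column_step)"

text \<open>Repeated variables cancel in pairs, so the coefficient of \<open>x\<close> is the parity
  of its occurrences in the clause. Pushing the coefficients reverses the clause order.\<close>

lemma timed_column_step:
  assumes "fits z s" "1 < z"
    and "s 2 = enc_list enc_nat (x # xs)" "s 3 = enc_cnf (C # \<psi>)" "s 10 = enc_vec w"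
    and "\<forall>i\<in>{4, 5, 6, 7, 8}. s i = NIL"
  shows "timed z column_step s
    (s(3 := enc_cnf \<psi>, 10 := enc_vec ((\<Sum>i\<leftarrow>fst C. of_bool (i = x)) # w)))"
proof -
  let ?g = "\<lambda>y p. p + of_bool (y = x)"
  let ?p = "\<Sum>i\<leftarrow>fst C. of_bool (i = x)"
  let ?s = "s(4 := enc_list enc_nat (fst C))" and ?t = "s(8 := enc_bit ?p)"
  have sz: "size (enc_list enc_nat (fst C)) < z"
    using fitsD [OF assms(1), of 3] assms(4) by (simp add: enc_cnf_def enc_clause_def)
  have fold: "fold ?g ys p = p + (\<Sum>i\<leftarrow>ys. of_bool (i = x))" for ys and p :: bit
    by (induction ys arbitrary: p) (auto simp: add.assoc)
  have "timed z (Assign 4 (Tl (Hd (Var 3)))) s ?s"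
    using assms by (intro timed_straight) (auto simp: enc_cnf_def enc_clause_def)
  moreover have "timed z (While (Var 4) count_step) ?s ?t"
  proof (rule timed_While_fold
      [where st = "\<lambda>ys p. s(4 := enc_list enc_nat ys, 8 := enc_bit p)" and g = ?g
        and xs = "fst C" and a = 0 and Q = "\<lambda>ys p. size (enc_list enc_nat ys) < z"])
    show "length (fst C) < z"
      using sz length_le_size_enc_list [of "fst C" enc_nat] by simp
  next
    fix y ys and p :: bit
    let ?u = "s(4 := enc_list enc_nat (y # ys), 8 := enc_bit p)"
    assume "size (enc_list enc_nat (y # ys)) < z"
    then have "timed z count_step ?u (?u(4 := enc_list enc_nat ys, 8 := enc_bit (?g y p)))"
      using assms by (intro timed_count_step fits_upd) (auto simp: enc_bit_def)
    moreover have "?u(4 := enc_list enc_nat ys, 8 := enc_bit (?g y p))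
        = s(4 := enc_list enc_nat ys, 8 := enc_bit (?g y p))"
      by (auto simp: fun_eq_iff)
    ultimately show "timed z count_step ?u (s(4 := enc_list enc_nat ys, 8 := enc_bit (?g y p)))"
      by simp
  next
    fix ys and p :: bit
    assume "size (enc_list enc_nat ys) < z"
    then show "fits z (s(4 := enc_list enc_nat ys, 8 := enc_bit p))"
      using assms by (intro fits_upd) (auto simp: enc_bit_def)
  qed (use assms sz in \<open>auto simp: fun_eq_iff fold\<close>)
  moreover have "timed z (Seq (push 10 (Var 8)) (Seq (Assign 8 Nil_exp) (pop 3))) ?t
      (s(3 := enc_cnf \<psi>, 10 := enc_vec (?p # w)))"
    using assms by (intro timed_straight fits_upd) (auto simp: fun_eq_iff enc_cnf_def enc_bit_def)
  ultimately show ?thesis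
    unfolding column_step_def by (blast intro: timed_Seq)
qed

lemma timed_column_com:
  assumes "fits z s" "room (length \<phi>) z"
    and "s 0 = enc_cnf \<phi>" "s 2 = enc_list enc_nat (x # xs)"
    and "\<forall>i\<in>{3, 4, 5, 6, 7, 8, 10}. s i = NIL"
  shows "timed z column_com s (s(10 := enc_vec (column \<phi> x)))"
proof -
  let ?g = "\<lambda>C. (#) (\<Sum>i\<leftarrow>fst C. of_bool (i = x))"
  have fold: "fold ?g \<psi> w = column \<psi> x @ w" for \<psi> w
    by (induction \<psi> arbitrary: w) (auto simp: column_def lin_def)
  have z: "1 < z"
    using assms(2) by (simp add: room_def)
  have sz: "size (enc_cnf \<phi>) < z"
    using fitsD [OF assms(1), of 0] assms(3) by simp
  have "timed z (Assign 3 (Var 0)) s (s(3 := enc_cnf \<phi>))"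
    using assms by (intro timed_straight) auto
  moreover have "timed z (While (Var 3) column_step) (s(3 := enc_cnf \<phi>)) (s(10 := enc_vec (column \<phi> x)))"
  proof (rule timed_While_fold
      [where st = "\<lambda>\<psi> w. s(3 := enc_cnf \<psi>, 10 := enc_vec w)" and g = ?g and xs = \<phi> and a = "[]"
        and Q = "\<lambda>\<psi> w. size (enc_cnf \<psi>) < z \<and> length \<psi> + length w \<le> length \<phi>"])
    show "length \<phi> < z"
      using sz length_le_size_enc_list [of \<phi> enc_clause] by (simp add: enc_cnf_def)
  next
    fix C \<psi> and w :: "bit list"
    let ?u = "s(3 := enc_cnf (C # \<psi>), 10 := enc_vec w)"
    assume Q: "size (enc_cnf (C # \<psi>)) < z \<and> length (C # \<psi>) + length w \<le> length \<phi>"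
    then show "size (enc_cnf \<psi>) < z \<and> length \<psi> + length (?g C w) \<le> length \<phi>"
      by (simp add: enc_cnf_def)
    have "timed z column_step ?u (?u(3 := enc_cnf \<psi>, 10 := enc_vec (?g C w)))"
      using assms Q z
      by (intro timed_column_step fits_upd room_size_vec [OF assms(2)]) auto
    moreover have "?u(3 := enc_cnf \<psi>, 10 := enc_vec (?g C w)) = s(3 := enc_cnf \<psi>, 10 := enc_vec (?g C w))"
      by (auto simp: fun_eq_iff)
    ultimately show "timed z column_step ?u (s(3 := enc_cnf \<psi>, 10 := enc_vec (?g C w)))"
      by simp
  next
    fix \<psi> and w :: "bit list"
    assume "size (enc_cnf \<psi>) < z \<and> length \<psi> + length w \<le> length \<phi>"
    then show "fits z (s(3 := enc_cnf \<psi>, 10 := enc_vec w))"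
      using assms by (intro fits_upd room_size_vec [OF assms(2)]) auto
  qed (use assms sz in \<open>auto simp: fun_eq_iff fold enc_cnf_def\<close>)
  ultimately show ?thesis
    unfolding column_com_def by (rule timed_Seq)
qed

section \<open>The echelon basis of the column space\<close>

definition variable_step :: com where
  "variable_step = Seq column_com (Seq insert_com (pop 2))"

definition clause_step :: com where
  "clause_step = Seq (Assign 2 (Tl (Hd (Var 1)))) (Seq (While (Var 2) variable_step) (pop 1))"

definition basis_com :: com where
  "basis_com = Seq (Assign 1 (Var 0)) (While (Var 1) clause_step)"

abbreviation insert_column :: "xor_cnf \<Rightarrow> nat \<Rightarrow> bit list list \<Rightarrow> bit list list" where
  "insert_column \<phi> x \<equiv> insert_vec (column \<phi> x)"

lemma echelon_fold_insert_column:
  "echelon S \<Longrightarrow> length S = length \<phi> \<Longrightarrow>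
    echelon (fold (insert_column \<phi>) xs S) \<and> length (fold (insert_column \<phi>) xs S) = length \<phi>"
  by (induction xs arbitrary: S) (auto simp: echelon_insert_vec)

lemma room_size_echelon:
  assumes "room m z" "echelon S" "length S = m"
  shows "size (enc_mat S) < z"
  using assms echelon_length [of S] by (intro room_size_mat [of m]) auto

text \<open>These variables are \<open>NIL\<close> again after each insertion, so the loop
  invariants below need to mention only the remaining input and the basis.\<close>

abbreviation scratch :: "nat set" where
  "scratch \<equiv> {3, 4, 5, 6, 7, 8, 10, 11, 12, 14}"

lemma timed_clause_step:
  assumes "fits z s" "room (length \<phi>) z" "echelon S" "length S = length \<phi>"
    and "s 0 = enc_cnf \<phi>" "s 1 = enc_cnf (C # \<psi>)" "s 2 = NIL" "s 9 = enc_mat S"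
    and "\<forall>i\<in>scratch. s i = NIL"
  shows "timed z clause_step s
    (s(1 := enc_cnf \<psi>, 9 := enc_mat (fold (insert_column \<phi>) (fst C) S)))"
proof -
  have sz: "size (enc_list enc_nat (fst C)) < z"
    using fitsD [OF assms(1), of 1] assms(6) by (simp add: enc_cnf_def enc_clause_def)
  let ?S = "fold (insert_column \<phi>) (fst C) S"
  let ?s = "s(2 := enc_list enc_nat (fst C))" and ?t = "s(9 := enc_mat ?S)"
  have "timed z (Assign 2 (Tl (Hd (Var 1)))) s ?s"
    using assms by (intro timed_straight) (auto simp: enc_cnf_def enc_clause_def)
  moreover have "timed z (While (Var 2) variable_step) ?s ?t"
  proof (rule timed_While_fold
      [where st = "\<lambda>xs S. s(2 := enc_list enc_nat xs, 9 := enc_mat S)" and g = "insert_column \<phi>"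
        and xs = "fst C" and a = S
        and Q = "\<lambda>xs S. size (enc_list enc_nat xs) < z \<and> echelon S \<and> length S = length \<phi>"])
    show "length (fst C) < z"
      using sz length_le_size_enc_list [of "fst C" enc_nat] by simp
  next
    fix x xs and S :: "bit list list"
    assume Q: "size (enc_list enc_nat (x # xs)) < z \<and> echelon S \<and> length S = length \<phi>"
    then show "size (enc_list enc_nat xs) < z \<and> echelon (insert_column \<phi> x S) \<and>
        length (insert_column \<phi> x S) = length \<phi>"
      by (simp add: echelon_insert_vec)
    then have szS: "size (enc_mat (insert_column \<phi> x S)) < z"
      using room_size_echelon [OF assms(2)] by simp
    let ?s = "s(2 := enc_list enc_nat (x # xs), 9 := enc_mat S)"
    let ?t = "s(2 := enc_list enc_nat (x # xs), 9 := enc_mat (insert_column \<phi> x S))"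
    let ?u = "s(2 := enc_list enc_nat xs, 9 := enc_mat (insert_column \<phi> x S))"
    have fits: "fits z ?s"
      using assms Q by (intro fits_upd room_size_echelon [OF assms(2)]) auto
    then have col: "timed z column_com ?s (?s(10 := enc_vec (column \<phi> x)))"
      using assms Q by (intro timed_column_com) auto
    have ins: "timed z insert_com (?s(10 := enc_vec (column \<phi> x)))
        (?s(10 := enc_vec (column \<phi> x), 9 := enc_mat (insert_column \<phi> x S), 10 := NIL))"
      using assms Q fits
      by (intro timed_insert_com [where m = "length \<phi>"] fits_upd room_size_vec [OF assms(2)]
          room_size_echelon [OF assms(2)]) auto
    have "?s(10 := enc_vec (column \<phi> x), 9 := enc_mat (insert_column \<phi> x S), 10 := NIL) = ?t"
      using assms by (auto simp: fun_eq_iff)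
    note col ins [unfolded this]
    moreover have "timed z (pop 2) ?t ?u"
      using assms Q szS by (intro timed_straight fits_upd) (auto simp: fun_eq_iff)
    ultimately show "timed z variable_step ?s ?u"
      unfolding variable_step_def by (intro timed_Seq)
  next
    fix xs and S :: "bit list list"
    assume "size (enc_list enc_nat xs) < z \<and> echelon S \<and> length S = length \<phi>"
    then show "fits z (s(2 := enc_list enc_nat xs, 9 := enc_mat S))"
      using assms by (intro fits_upd room_size_echelon [OF assms(2)]) auto
  qed (use assms sz in \<open>auto simp: fun_eq_iff\<close>)
  moreover have "timed z (pop 1) ?t (s(1 := enc_cnf \<psi>, 9 := enc_mat ?S))"
    using assms echelon_fold_insert_column [of S \<phi> "fst C"]
    by (intro timed_straight fits_upd room_size_echelon [OF assms(2)])
      (auto simp: fun_eq_iff enc_cnf_def)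
  ultimately show ?thesis
    unfolding clause_step_def by (blast intro: timed_Seq)
qed

lemma timed_basis_com:
  assumes "fits z s" "room (length \<phi>) z"
    and "s 0 = enc_cnf \<phi>" "s 1 = NIL" "s 2 = NIL" "s 9 = enc_mat (replicate (length \<phi>) [])"
    and "\<forall>i\<in>scratch. s i = NIL"
  shows "timed z basis_com s (s(9 := enc_mat (sig_basis \<phi>)))"
proof -
  let ?g = "\<lambda>C. fold (insert_column \<phi>) (fst C)"
  have fold: "fold ?g \<psi> S = fold (insert_column \<phi>) (occurrences \<psi>) S" for \<psi> S
    by (induction \<psi> arbitrary: S) (auto simp: occurrences_def)
  have ech: "echelon (replicate n [])" for n
    by (induction n) auto
  have sz: "size (enc_cnf \<phi>) < z"
    using fitsD [OF assms(1), of 0] assms(3) by simp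
  have "timed z (Assign 1 (Var 0)) s (s(1 := enc_cnf \<phi>))"
    using assms by (intro timed_straight) auto
  moreover have "timed z (While (Var 1) clause_step) (s(1 := enc_cnf \<phi>)) (s(9 := enc_mat (sig_basis \<phi>)))"
  proof (rule timed_While_fold
      [where st = "\<lambda>\<psi> S. s(1 := enc_cnf \<psi>, 9 := enc_mat S)" and g = ?g and xs = \<phi>
        and a = "replicate (length \<phi>) []"
        and Q = "\<lambda>\<psi> S. size (enc_cnf \<psi>) < z \<and> echelon S \<and> length S = length \<phi>"])
    show "length \<phi> < z"
      using sz length_le_size_enc_list [of \<phi> enc_clause] by (simp add: enc_cnf_def)
  next
    fix C \<psi> and S :: "bit list list"
    let ?u = "s(1 := enc_cnf (C # \<psi>), 9 := enc_mat S)"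
    assume Q: "size (enc_cnf (C # \<psi>)) < z \<and> echelon S \<and> length S = length \<phi>"
    then show "size (enc_cnf \<psi>) < z \<and> echelon (?g C S) \<and> length (?g C S) = length \<phi>"
      using echelon_fold_insert_column [of S \<phi> "fst C"] by (simp add: enc_cnf_def)
    have "timed z clause_step ?u (?u(1 := enc_cnf \<psi>, 9 := enc_mat (?g C S)))"
      using assms Q by (intro timed_clause_step fits_upd room_size_echelon [OF assms(2)]) auto
    moreover have "?u(1 := enc_cnf \<psi>, 9 := enc_mat (?g C S)) = s(1 := enc_cnf \<psi>, 9 := enc_mat (?g C S))"
      by (auto simp: fun_eq_iff)
    ultimately show "timed z clause_step ?u (s(1 := enc_cnf \<psi>, 9 := enc_mat (?g C S)))"
      by simp
  next
    fix \<psi> and S :: "bit list list"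
    assume "size (enc_cnf \<psi>) < z \<and> echelon S \<and> length S = length \<phi>"
    then show "fits z (s(1 := enc_cnf \<psi>, 9 := enc_mat S))"
      using assms by (intro fits_upd room_size_echelon [OF assms(2)]) auto
  qed (use assms sz ech in \<open>auto simp: fun_eq_iff fold sig_basis_def enc_cnf_def\<close>)
  ultimately show ?thesis
    unfolding basis_com_def by (rule timed_Seq)
qed

section \<open>Offset, empty basis and zero vector\<close>

definition init_step :: com where
  "init_step =
    Seq (push 9 Nil_exp)
      (Seq (If (Hd (Hd (Var 1))) (push 15 Nil_exp) (push 15 true_exp)) (pop 1))"

definition init_com :: com where
  "init_com = Seq (Assign 1 (Var 0)) (Seq (While (Var 1) init_step) (Assign 17 (Var 9)))"

lemma timed_init_com:
  assumes "fits z s" "room (length \<phi>) z"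
    and "s 0 = enc_cnf \<phi>" "s 1 = NIL" "s 9 = NIL" "s 15 = NIL"
  shows "timed z init_com s
    (s(9 := enc_mat (replicate (length \<phi>) []), 15 := enc_vec (offset \<phi>),
      17 := enc_vec (replicate (length \<phi>) 0)))"
proof -
  let ?g = "\<lambda>C (n, b). (Suc n, (snd C + 1) # b)"
  have fold: "fold ?g \<psi> (n, b) = (length \<psi> + n, offset \<psi> @ b)" for \<psi> :: xor_cnf and n b
    by (induction \<psi> arbitrary: n b) (auto simp: offset_def)
  have sz: "size (enc_cnf \<phi>) < z"
    using fitsD [OF assms(1), of 0] assms(3) by simp
  \<comment> \<open>The bit 0 and the empty row are both encoded by \<open>NIL\<close>, so a copy of
    the empty basis serves as the zero vector.\<close>
  have zeros: "enc_vec (replicate n 0) = enc_mat (replicate n [])" for n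
    by (induction n) auto
  let ?s = "s(9 := enc_mat (replicate (length \<phi>) []), 15 := enc_vec (offset \<phi>))"
  have fits: "fits z (s(1 := enc_cnf \<psi>, 9 := enc_mat (replicate n []), 15 := enc_vec b))"
    if "size (enc_cnf \<psi>) < z" "length \<psi> + n \<le> length \<phi>" "length \<psi> + length b \<le> length \<phi>" for \<psi> n b
    using that assms by (intro fits_upd room_size_vec [OF assms(2)] room_size_mat [OF assms(2)]) auto
  have "timed z (Assign 1 (Var 0)) s (s(1 := enc_cnf \<phi>))"
    using assms by (intro timed_straight) auto
  moreover have "timed z (While (Var 1) init_step) (s(1 := enc_cnf \<phi>)) ?s"
  proof (rule timed_While_fold
      [where st = "\<lambda>\<psi> (n, b). s(1 := enc_cnf \<psi>, 9 := enc_mat (replicate n []), 15 := enc_vec b)"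
        and g = ?g and xs = \<phi> and a = "(0, [])"
        and Q = "\<lambda>\<psi> (n, b). size (enc_cnf \<psi>) < z \<and> length \<psi> + n \<le> length \<phi> \<and>
          length \<psi> + length b \<le> length \<phi>"])
    show "length \<phi> < z"
      using sz length_le_size_enc_list [of \<phi> enc_clause] by (simp add: enc_cnf_def)
  next
    fix C \<psi> and a :: "nat \<times> bit list"
    assume "case a of (n, b) \<Rightarrow> size (enc_cnf (C # \<psi>)) < z \<and> length (C # \<psi>) + n \<le> length \<phi> \<and>
        length (C # \<psi>) + length b \<le> length \<phi>"
    then show "timed z init_step
        (case a of (n, b) \<Rightarrow> s(1 := enc_cnf (C # \<psi>), 9 := enc_mat (replicate n []), 15 := enc_vec b))
        (case ?g C a of (n, b) \<Rightarrow> s(1 := enc_cnf \<psi>, 9 := enc_mat (replicate n []), 15 := enc_vec b))"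
      unfolding init_step_def using fits [of "C # \<psi>" "fst a" "snd a"]
      by (intro timed_straight) (auto simp: fun_eq_iff enc_cnf_def enc_clause_def)
  qed (use assms sz fits in \<open>auto simp: fun_eq_iff enc_cnf_def fold\<close>)
  moreover have "timed z (Assign 17 (Var 9)) ?s (?s(17 := enc_vec (replicate (length \<phi>) 0)))"
    using assms
    by (intro timed_straight fits_upd room_size_vec [OF assms(2)] room_size_mat [OF assms(2)])
      (auto simp: fun_eq_iff zeros)
  ultimately show ?thesis
    unfolding init_com_def by (blast intro: timed_Seq)
qed

section \<open>Successor of an element of the span\<close>

definition next_head :: com where
  "next_head =
    If (Var 16)
      (If (Hd (Var 13))
        (Seq (Seq (If (Hd (Var 10)) Skip (Assign 16 Nil_exp)) (Assign 11 (Hd (Var 13)))) xor_com)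
        Skip)
      Skip"

definition next_step :: com where
  "next_step = Seq next_head (Seq (push 14 (Hd (Var 10))) (Seq (pop 10) (pop 13)))"

text \<open>Variable 16 is true on entry as loop condition and thereby supplies the incoming carry.
  Negating the outgoing carry ends the outer loop on overflow, and otherwise sets the carry for the
  next increment.\<close>

definition next_com :: com where
  "next_com =
    Seq (Seq (Assign 12 Nil_exp) (Seq (Assign 10 (Var 17)) (Seq (Assign 13 (Var 9)) (Assign 17 Nil_exp))))
      (Seq (While (Var 13) next_step)
        (Seq (move 14 17) (If (Var 16) (Assign 16 Nil_exp) (Assign 16 true_exp))))"

fun next_acc :: "bit list \<Rightarrow> bool \<times> bit list \<times> bit list \<Rightarrow> bool \<times> bit list \<times> bit list" where
  "next_acc r (c, v, A) =
    (if c \<and> r \<noteq> [] then (hd v = 1, vxor (tl v) (tl r), (hd v + 1) # A) else (c, tl v, hd v # A))"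

lemma fold_next_acc:
  "length v = length S \<Longrightarrow> echelon S \<Longrightarrow> next_vec c v S = (u, c') \<Longrightarrow>
    fold next_acc S (c, v, A) = (c', [], rev u @ A)"
  by (induction c v S arbitrary: A u rule: next_vec.induct)
    (fastforce simp: apfst_def map_prod_def split: if_splits prod.splits)+

text \<open>The whole row is added, and its leading 1 flips the current digit. The old digit is the
  new carry, so it is tested before the addition.\<close>

lemma timed_next_step:
  assumes "fits z s" "room m z" "echelon (r # S)" "length v = Suc (length S)" "length v + length A \<le> m"
    and "s 13 = enc_mat (r # S)" "s 10 = enc_vec v" "s 11 = NIL" "s 12 = NIL" "s 14 = enc_vec A"
      "s 16 = enc_bit (of_bool c)"
    and "next_acc r (c, v, A) = (c', v', A')"
  shows "timed z next_step s
    (s(10 := enc_vec v', 13 := enc_mat S, 14 := enc_vec A', 16 := enc_bit (of_bool c')))"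
proof -
  obtain a u where v: "v = a # u"
    using assms by (cases v) auto
  let ?w = "if c \<and> r \<noteq> [] then vxor v r else v"
  let ?t = "s(10 := enc_vec ?w, 16 := enc_bit (of_bool c'))"
  have z: "1 < z"
    using assms(2) by (simp add: room_def)
  have "timed z next_head s ?t"
    unfolding next_head_def
  proof (intro timed_If assms)
    assume "eval (Var 16) s \<noteq> NIL"
    then have c by (simp add: assms)
    let ?s = "s(11 := enc_vec r, 16 := enc_bit (of_bool c'))"
    show "timed z (Seq (Seq (If (Hd (Var 10)) Skip (Assign 16 Nil_exp)) (Assign 11 (Hd (Var 13)))) xor_com) s ?t"
      if "eval (Hd (Var 13)) s \<noteq> NIL"
    proof (rule timed_Seq)
      have r: "r \<noteq> []"
        using that assms by auto
      show "timed z (Seq (If (Hd (Var 10)) Skip (Assign 16 Nil_exp)) (Assign 11 (Hd (Var 13)))) s ?s"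
        using assms \<open>c\<close> r v by (intro timed_straight) (auto simp: fun_eq_iff)
      have "timed z xor_com ?s (?s(10 := enc_vec (vxor v r), 11 := NIL))"
        using assms r z
        by (intro timed_xor_com [where m = m] fits_upd room_size_vec [OF assms(2)])
          (auto simp: enc_bit_def)
      moreover have "?s(10 := enc_vec (vxor v r), 11 := NIL) = ?t"
        using assms r \<open>c\<close> by (auto simp: fun_eq_iff)
      ultimately show "timed z xor_com ?s ?t" by simp
    qed
    show "timed z Skip s ?t" if "eval (Hd (Var 13)) s = NIL"
      using that assms by (intro timed_straight) (auto simp: fun_eq_iff)
  next
    assume "eval (Var 16) s = NIL"
    then show "timed z Skip s ?t"
      using assms by (intro timed_straight) (auto simp: fun_eq_iff)
  qed
  moreover have "timed z (Seq (push 14 (Hd (Var 10))) (Seq (pop 10) (pop 13))) ?t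
      (s(10 := enc_vec v', 13 := enc_mat S, 14 := enc_vec A', 16 := enc_bit (of_bool c')))"
    using assms z v
    by (intro timed_straight fits_upd room_size_vec [OF assms(2)])
      (cases r; auto simp: fun_eq_iff enc_bit_def split: if_splits)+
  ultimately show ?thesis
    unfolding next_step_def by (rule timed_Seq)
qed


lemma timed_next_com:
  assumes "fits z s" "room m z" "echelon S" "length S = m" "length v = m"
    and "s 9 = enc_mat S" "s 17 = enc_vec v" "s 16 = enc_bit 1" "\<forall>i\<in>{10, 11, 13, 14}. s i = NIL"
    and nxt: "next_vec True v S = (u, c)"
  shows "timed z next_com s (s(12 := NIL, 16 := enc_bit (of_bool (\<not> c)), 17 := enc_vec u))"
proof -
  have z: "1 < z"
    using assms(2) by (simp add: room_def)
  have u: "length u \<le> m"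
    using length_next_vec [of v S True] nxt assms by simp
  let ?s = "s(9 := enc_mat S, 10 := enc_vec v, 12 := NIL, 13 := enc_mat S, 17 := NIL)"
  let ?t = "s(12 := NIL, 14 := enc_vec (rev u), 16 := enc_bit (of_bool c), 17 := NIL)"
  let ?st = "\<lambda>S (c, v, A). s(10 := enc_vec v, 12 := NIL, 13 := enc_mat S, 14 := enc_vec A,
    16 := enc_bit (of_bool c), 17 := NIL)"
  let ?Q = "\<lambda>S (c :: bool, v :: bit list, A :: bit list).
    echelon S \<and> length v = length S \<and> length v + length A \<le> m"
  have fits: "fits z (?st S a)" if "?Q S a" for S a
    using that assms(1) z echelon_length [of S]
    by (cases a) (fastforce simp: enc_bit_def
      intro!: fits_upd room_size_vec [OF assms(2)] room_size_mat [OF assms(2)])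
  have "timed z (Seq (Assign 12 Nil_exp) (Seq (Assign 10 (Var 17)) (Seq (Assign 13 (Var 9)) (Assign 17 Nil_exp))))
      s ?s"
    using assms by (intro timed_straight) (auto simp: fun_eq_iff)
  moreover have "timed z (While (Var 13) next_step) ?s ?t"
  proof (rule timed_While_fold
      [where st = ?st and Q = ?Q and g = next_acc and xs = S and a = "(True, v, [])"])
    show "length S < z"
      using assms room_size_vec [OF assms(2), of v] length_le_size_enc_list [of v enc_bit] by simp
  next
    fix r S and a :: "bool \<times> bit list \<times> bit list"
    assume "?Q (r # S) a"
    then obtain c v A where a: "a = (c, v, A)"
      and Q: "echelon (r # S)" "length v = Suc (length S)" "length v + length A \<le> m"
      by (cases a) auto
    obtain c' v' A' where acc: "next_acc r (c, v, A) = (c', v', A')"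
      by (metis prod_cases3)
    show "?Q S (next_acc r a)"
      using Q by (auto simp: a)
    let ?s = "?st (r # S) (c, v, A)"
    have "timed z next_step ?s
        (?s(10 := enc_vec v', 13 := enc_mat S, 14 := enc_vec A', 16 := enc_bit (of_bool c')))"
      using Q assms acc fits [OF \<open>?Q (r # S) a\<close>]
      by (intro timed_next_step [where m = m and v = v and A = A and r = r and c = c]) (auto simp: a)
    moreover have "?s(10 := enc_vec v', 13 := enc_mat S, 14 := enc_vec A', 16 := enc_bit (of_bool c'))
        = ?st S (c', v', A')"
      by (auto simp: fun_eq_iff)
    ultimately show "timed z next_step (?st (r # S) a) (?st S (next_acc r a))"
      unfolding a acc by simp
  qed (use assms fits fold_next_acc [OF _ _ nxt] in \<open>auto simp: fun_eq_iff\<close>)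
  moreover have "timed z (move 14 17) ?t (?t(14 := NIL, 17 := enc_vec (rev (rev u) @ [])))"
    using assms u z
    by (intro timed_move fits_upd room_size_vec [OF assms(2)]) (auto simp: enc_bit_def room_size_vec)
  moreover have "timed z (If (Var 16) (Assign 16 Nil_exp) (Assign 16 true_exp))
      (?t(14 := NIL, 17 := enc_vec (rev (rev u) @ [])))
      (s(12 := NIL, 16 := enc_bit (of_bool (\<not> c)), 17 := enc_vec u))"
    using assms u z
    by (intro timed_straight fits_upd room_size_vec [OF assms(2)])
      (auto simp: fun_eq_iff enc_bit_def room_size_vec)
  ultimately show ?thesis
    unfolding next_com_def by (blast intro: timed_Seq)
qed

section \<open>The enumerating program\<close>

definition prepare_com :: com where
  "prepare_com = Seq init_com (Seq basis_com (Assign 16 true_exp))"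

definition output_com :: com where
  "output_com = Seq (Seq (Assign 10 (Var 17)) (Assign 11 (Var 15))) xor_push"

definition round_com :: com where
  "round_com = Seq output_com (Seq (Emit (Var 12)) next_com)"

definition program :: com where
  "program = Seq prepare_com (While (Var 16) round_com)"

text \<open>The store at each test of the outer loop. All working variables are \<open>NIL\<close>,
  so nothing accumulates over the rounds.\<close>

definition main_store :: "xor_cnf \<Rightarrow> bit list \<Rightarrow> bool \<Rightarrow> store" where
  "main_store \<phi> u c = (\<lambda>_. NIL)(0 := enc_cnf \<phi>, 9 := enc_mat (sig_basis \<phi>),
    15 := enc_vec (offset \<phi>), 16 := enc_bit (of_bool c), 17 := enc_vec u)"

lemma fits_NIL: "0 < z \<Longrightarrow> fits z (\<lambda>_. NIL)"
  by (simp add: fits_def)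

lemma fits_main_store:
  assumes "room (length \<phi>) z" "size (enc_cnf \<phi>) < z" "length u = length \<phi>"
  shows "fits z (main_store \<phi> u c)"
  unfolding main_store_def using assms
  by (intro fits_upd fits_NIL room_size_vec [OF assms(1)] room_size_echelon [OF assms(1)])
    (auto simp: sig_basis enc_bit_def room_def)

lemma timed_prepare_com:
  assumes "room (length \<phi>) z" "size (enc_cnf \<phi>) < z"
  shows "timed z prepare_com (initial_store (enc_cnf \<phi>)) (main_store \<phi> (replicate (length \<phi>) 0) True)"
proof -
  let ?s0 = "initial_store (enc_cnf \<phi>)"
  let ?s1 = "?s0(9 := enc_mat (replicate (length \<phi>) []), 15 := enc_vec (offset \<phi>),
      17 := enc_vec (replicate (length \<phi>) 0))"
  let ?s2 = "?s1(9 := enc_mat (sig_basis \<phi>))"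
  have fits: "fits z ?s0"
    using assms unfolding initial_store_def by (intro fits_upd fits_NIL) auto
  then have "timed z init_com ?s0 ?s1"
    using assms by (intro timed_init_com) (auto simp: initial_store_def)
  moreover have "timed z basis_com ?s1 ?s2"
    using assms fits
    by (intro timed_basis_com fits_upd room_size_vec [OF assms(1)] room_size_mat [OF assms(1)])
      (auto simp: initial_store_def)
  moreover have "timed z (Assign 16 true_exp) ?s2 (main_store \<phi> (replicate (length \<phi>) 0) True)"
    using assms fits
    by (intro timed_straight fits_upd room_size_vec [OF assms(1)] room_size_mat [OF assms(1)]
        room_size_echelon [OF assms(1)])
      (auto simp: fun_eq_iff main_store_def initial_store_def sig_basis)
  ultimately show ?thesis
    unfolding prepare_com_def by (blast intro: timed_Seq)
qed

section \<open>Delay and space of the enumeration\<close>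

lemma delays_from_silent:
  "outputs tr = [] \<Longrightarrow> delays_from n (tr @ tr') = delays_from (n + sum_list (map cost tr)) tr'"
proof (induction tr arbitrary: n)
  case (Cons e tr)
  then show ?case
    by (cases e; cases "emitted e") (auto simp: add.assoc)
qed simp

text \<open>One \<open>z\<close> pays for evaluating the output; the other is kept in reserve by
  \<open>exec_round_com\<close> for the loop test in front of the round.\<close>

definition round_time :: "nat \<Rightarrow> nat" where
  "round_time z = 2 * z + time output_com z + time next_com z"

lemma exec_round_com:
  assumes "room (length \<phi>) z" "size (enc_cnf \<phi>) < z" "length u = length \<phi>"
    and "next_vec True u (sig_basis \<phi>) = (v, c)"
  obtains tr tr' e where "exec round_com (main_store \<phi> u True) (tr @ e # tr') (main_store \<phi> v (\<not> c))"
    and "outputs tr = []" "outputs tr' = []" "emitted e = Some (enc_signature (output_vec \<phi> u))"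
    and "z + sum_list (map cost (tr @ e # tr')) \<le> round_time z"
proof -
  let ?s = "main_store \<phi> u True" and ?t = "main_store \<phi> v (\<not> c)"
  let ?s1 = "?s(10 := enc_vec u, 11 := enc_vec (offset \<phi>))"
  let ?s2 = "?s(12 := enc_vec (output_vec \<phi> u))"
  have fits: "fits z ?s"
    using assms by (intro fits_main_store)
  have "timed z (Seq (Assign 10 (Var 17)) (Assign 11 (Var 15))) ?s ?s1"
    using fits by (intro timed_straight) (auto simp: main_store_def)
  moreover have "timed z xor_push ?s1 (?s1(10 := NIL, 11 := NIL, 12 := enc_vec (rev (vxor u (offset \<phi>)))))"
    using fits assms
    by (intro timed_xor_push fits_upd room_size_vec [OF assms(1)]) (auto simp: main_store_def)
  moreover have "?s1(10 := NIL, 11 := NIL, 12 := enc_vec (rev (vxor u (offset \<phi>)))) = ?s2"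
    by (auto simp: fun_eq_iff main_store_def output_vec_def)
  ultimately have "timed z output_com ?s ?s2"
    unfolding output_com_def by (metis timed_Seq)
  then obtain tr where tr: "exec output_com ?s tr ?s2" "outputs tr = []"
    "sum_list (map cost tr) \<le> time output_com z"
    unfolding timed_def runs_def by blast
  have fits2: "fits z ?s2"
    using fits assms by (intro fits_upd room_size_vec [OF assms(1)]) (auto simp: output_vec_def)
  then have "timed z next_com ?s2 (?s2(12 := NIL, 16 := enc_bit (of_bool (\<not> c)), 17 := enc_vec v))"
    using assms
    by (intro timed_next_com [where m = "length \<phi>" and S = "sig_basis \<phi>" and v = u])
      (auto simp: main_store_def sig_basis)
  moreover have "?s2(12 := NIL, 16 := enc_bit (of_bool (\<not> c)), 17 := enc_vec v) = ?t"
    by (auto simp: fun_eq_iff main_store_def)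
  ultimately obtain tr' where tr': "exec next_com ?s2 tr' ?t" "outputs tr' = []"
    "sum_list (map cost tr') \<le> time next_com z"
    unfolding timed_def runs_def by auto
  let ?e = "Event (exp_cost (Var 12) ?s2) (Some (eval (Var 12) ?s2)) ?s2"
  have "exec round_com ?s (tr @ ([?e] @ tr')) ?t"
    unfolding round_com_def by (rule exec.Seq [OF tr(1) exec.Seq [OF exec.Emit tr'(1)]])
  moreover have "cost ?e \<le> z"
    using exp_cost_le [OF fits2, of "Var 12"] by simp
  then have "z + sum_list (map cost (tr @ ?e # tr')) \<le> round_time z"
    using tr(3) tr'(3) by (simp add: round_time_def)
  moreover have "emitted ?e = Some (enc_signature (output_vec \<phi> u))"
    by (simp add: enc_signature_def)
  ultimately show thesis
    using that tr(2) tr'(2) by auto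
qed

lemma space_fits: "fits z s \<Longrightarrow> space P s \<le> card (com_vars P) * z"
  unfolding space_def using fitsD [of z s]
  by (intro order_trans [OF sum_bounded_above [of _ _ z]]) (auto simp: less_imp_le)

lemma size_eval_le_exp_cost: "size (eval e s) \<le> exp_cost e s"
  by (cases e) auto

text \<open>Since a step costs at least the size of the value it stores, a bound on the time bounds the
  space, too.\<close>

lemma space_after_exec:
  "exec c s tr t \<Longrightarrow>
    space P t \<le> space P s + sum_list (map cost tr) \<and>
    (\<forall>ev\<in>set tr. space P (store_after ev) \<le> space P s + sum_list (map cost tr))"
proof (induction rule: exec.induct)
  case (Assign t s x e)
  have "space P t \<le> space P s + size (eval e s)"
  proof (cases "x \<in> com_vars P")
    case True
    then show ?thesis
      using finite_com_vars [of P] by (simp add: space_def Assign sum.remove [of _ x])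
  next
    case False
    then have "space P t = space P s"
      unfolding space_def Assign by (intro sum.cong) auto
    then show ?thesis by simp
  qed
  then show ?case
    using size_eval_le_exp_cost [of e s] by simp
next
  case (Seq c s tr t d tr' u)
  then show ?case by fastforce
next
  case (WhileTrue e s c tr t tr' u)
  then show ?case by fastforce
qed fastforce+

text \<open>The time \<open>n\<close> spent before the loop enters the first delay only. A later
  delay joins the rest of one round to the start of the next or to the final test, hence twice
  \<open>round_time z\<close>. The space bound is independent of \<open>us\<close>, since each round
  starts from a store that fits \<open>z\<close>.\<close>

lemma exec_enumerate:
  assumes "room (length \<phi>) z" "size (enc_cnf \<phi>) < z"
    and "next_path (sig_basis \<phi>) us" "\<forall>u\<in>set us. length u = length \<phi>"
  shows "\<exists>tr t. exec (While (Var 16) round_com) (main_store \<phi> (hd us) True) tr t \<and>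
    outputs tr = map (\<lambda>u. enc_signature (output_vec \<phi> u)) us \<and>
    (\<forall>n. \<forall>d\<in>set (delays_from n tr). d \<le> max n (round_time z) + round_time z) \<and>
    (\<forall>ev\<in>set tr. space P (store_after ev) \<le> card (com_vars P) * z + round_time z)"
    (is "\<exists>tr t. ?R us tr t")
proof -
  let ?w = "While (Var 16) round_com" and ?S = "sig_basis \<phi>"
  \<comment> \<open>A round is put in front of a run for the remaining elements. For the last
    element this run is the failing test alone, with \<open>c\<close> true and \<open>us\<close>
    empty.\<close>
  have round: "\<exists>tr t. ?R (u # us) tr t"
    if u: "length u = length \<phi>" and nxt: "next_vec True u ?S = (v, c)"
      and w: "exec ?w (main_store \<phi> v (\<not> c)) trw t"
      and out: "outputs trw = map (\<lambda>u. enc_signature (output_vec \<phi> u)) us"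
      and del: "\<forall>n\<le>round_time z. \<forall>d\<in>set (delays_from n trw). d \<le> 2 * round_time z"
      and space: "\<forall>ev\<in>set trw. space P (store_after ev) \<le> card (com_vars P) * z + round_time z"
    for u v c us trw t
  proof -
    let ?s = "main_store \<phi> u True"
    have fits: "fits z ?s"
      using assms(1,2) u by (rule fits_main_store)
    from assms(1,2) u nxt obtain tr tr' e where
      r: "exec round_com ?s (tr @ e # tr') (main_store \<phi> v (\<not> c))"
        "outputs tr = []" "outputs tr' = []" "emitted e = Some (enc_signature (output_vec \<phi> u))"
        "z + sum_list (map cost (tr @ e # tr')) \<le> round_time z"
      by (rule exec_round_com)
    let ?c = "Event (exp_cost (Var 16) ?s) None ?s"
    let ?tr = "?c # (tr @ e # tr') @ trw"
    have cost: "cost ?c \<le> z"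
      using exp_cost_le [OF fits, of "Var 16"] by simp
    have "eval (Var 16) ?s \<noteq> NIL"
      by (simp add: main_store_def)
    then have "exec ?w ?s ?tr t"
      using r(1) w by (rule exec.WhileTrue)
    moreover have "outputs ?tr = map (\<lambda>u. enc_signature (output_vec \<phi> u)) (u # us)"
      using r out by (cases e) simp
    moreover have *: "delays_from n ?tr =
        (n + sum_list (map cost (?c # tr @ [e]))) # delays_from (sum_list (map cost tr')) trw" for n
      using r by (cases e) (simp add: delays_from_silent)
    have "d \<le> max n (round_time z) + round_time z" if "d \<in> set (delays_from n ?tr)" for n d
    proof -
      have "sum_list (map cost (?c # tr @ [e])) \<le> round_time z" "sum_list (map cost tr') \<le> round_time z"
        using r(5) cost by simp_all
      moreover from this del have "\<forall>d\<in>set (delays_from (sum_list (map cost tr')) trw). d \<le> 2 * round_time z"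
        by blast
      moreover have "d = n + sum_list (map cost (?c # tr @ [e])) \<or>
          d \<in> set (delays_from (sum_list (map cost tr')) trw)"
        using that * by (metis set_ConsD)
      ultimately show ?thesis
        by fastforce
    qed
    moreover have "space P (store_after ev) \<le> card (com_vars P) * z + round_time z"
      if ev: "ev \<in> set ?tr" for ev
    proof -
      have s: "space P ?s \<le> card (com_vars P) * z"
        using fits by (rule space_fits)
      consider "ev = ?c" | "ev \<in> set (tr @ e # tr')" | "ev \<in> set trw"
        using ev by auto
      then show ?thesis
      proof cases
        case 2
        then have "space P (store_after ev) \<le> space P ?s + sum_list (map cost (tr @ e # tr'))"
          using space_after_exec [OF r(1), of P] by blast
        with s r(5) show ?thesis by linarith
      qed (use s space in auto)
    qed
    ultimately show ?thesis by auto
  qed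
  show ?thesis
    using assms(3,4)
  proof (induction ?S us rule: next_path.induct)
    case (2 u)
    then obtain v where v: "next_vec True u ?S = (v, True)"
      by (cases "next_vec True u ?S") auto
    let ?t = "main_store \<phi> v (\<not> True)"
    have len: "length v = length \<phi>"
      using length_next_vec [of u ?S True] v 2 by (simp add: sig_basis)
    let ?e = "Event (exp_cost (Var 16) ?t) None ?t"
    have "exec ?w ?t [?e] ?t"
      by (intro exec.intros) (simp add: main_store_def)
    moreover have "cost ?e \<le> round_time z"
      by (simp add: main_store_def round_time_def) (use assms(1) in \<open>simp add: room_def\<close>)
    moreover have "space P ?t \<le> card (com_vars P) * z"
      using assms(1,2) len by (intro space_fits fits_main_store)
    ultimately show ?case
      using 2 v round [of u v True "[?e]" ?t "[]"] by simp
  next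
    case (3 u v us)
    from 3 have "\<exists>tr t. ?R (v # us) tr t"
      by (intro 3) auto
    then obtain tr t where R: "?R (v # us) tr t"
      by blast
    then have "\<forall>n\<le>round_time z. \<forall>d\<in>set (delays_from n tr). d \<le> 2 * round_time z"
      unfolding mult_2 by (metis max_absorb2)
    moreover from 3 have "next_vec True u ?S = (v, False)" "length u = length \<phi>"
      by auto
    ultimately show ?case
      using round [of u v False tr t "v # us"] R by simp
  qed simp
qed


section \<open>Polynomial bounds\<close>

definition polynomial_fun :: "(nat \<Rightarrow> nat) \<Rightarrow> bool" where
  "polynomial_fun f \<longleftrightarrow> (\<exists>p. \<forall>n. f n = poly p n)"

lemma polynomial_fun_const: "polynomial_fun (\<lambda>_. c)"
  unfolding polynomial_fun_def by (intro exI [of _ "[:c:]"]) simp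

lemma polynomial_fun_id: "polynomial_fun (\<lambda>n. n)"
  unfolding polynomial_fun_def by (intro exI [of _ "[:0, 1:]"]) simp

lemma polynomial_fun_add: "polynomial_fun f \<Longrightarrow> polynomial_fun g \<Longrightarrow> polynomial_fun (\<lambda>n. f n + g n)"
  unfolding polynomial_fun_def by (metis poly_add)

lemma polynomial_fun_mult: "polynomial_fun f \<Longrightarrow> polynomial_fun g \<Longrightarrow> polynomial_fun (\<lambda>n. f n * g n)"
  unfolding polynomial_fun_def by (metis poly_mult)

lemma polynomial_fun_comp: "polynomial_fun f \<Longrightarrow> polynomial_fun g \<Longrightarrow> polynomial_fun (\<lambda>n. f (g n))"
  unfolding polynomial_fun_def by (metis poly_pcompose)

lemmas polynomial_fun_intros =
  polynomial_fun_const polynomial_fun_id polynomial_fun_add polynomial_fun_mult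

text \<open>The command is fixed, so its weights are constants, and each loop around a command
  contributes a factor \<open>z\<close>.\<close>

lemma polynomial_fun_time: "polynomial_fun (time c)"
proof (induction c)
  case (Seq c d)
  then show ?case
    by (cases "straight (Seq c d)") (simp_all add: polynomial_fun_intros del: straight.simps)
next
  case (If e c d)
  then show ?case
    by (cases "straight (If e c d)") (simp_all add: polynomial_fun_intros del: straight.simps)
qed (simp_all add: polynomial_fun_intros)

lemma polynomial_fun_round_time: "polynomial_fun round_time"
  unfolding round_time_def [abs_def] by (intro polynomial_fun_intros polynomial_fun_time)

theorem theorem1:
  shows "\<exists>(P :: com) (p :: nat poly) (q :: nat poly). \<forall>\<phi> :: xor_cnf. \<exists>tr t \<sigma>s.
    exec P (initial_store (enc_cnf \<phi>)) tr t \<and>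
    outputs tr = map enc_signature \<sigma>s \<and>
    distinct \<sigma>s \<and> set \<sigma>s = signatures \<phi> \<and>
    delay_bounded tr (poly p (size (enc_cnf \<phi>))) \<and>
    space_bounded P (initial_store (enc_cnf \<phi>)) tr (poly q (size (enc_cnf \<phi>)))"
proof -
  \<comment> \<open>The result must exceed 1, the input size \<open>n\<close>, and
    \<open>m * (2 * m + 1)\<close> for the number \<open>m \<le> n\<close> of clauses.\<close>
  define bound where "bound n = n * (2 * n + 1) + n + 2" for n :: nat
  \<comment> \<open>The preparation is silent and lengthens only the first delay; the sum bounds the
    maximum in \<open>exec_enumerate\<close>.\<close>
  let ?delay = "\<lambda>z. time prepare_com z + 2 * round_time z"
  let ?space = "\<lambda>z. card (com_vars program) * z + time prepare_com z + round_time z"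
  have bound: "polynomial_fun bound"
    unfolding bound_def [abs_def] by (intro polynomial_fun_intros)
  have "polynomial_fun (\<lambda>n. ?delay (bound n))"
    by (rule polynomial_fun_comp [OF _ bound])
      (intro polynomial_fun_intros polynomial_fun_time polynomial_fun_round_time)
  then obtain p where p: "\<And>n. poly p n = ?delay (bound n)"
    unfolding polynomial_fun_def by metis
  have "polynomial_fun (\<lambda>n. ?space (bound n))"
    by (rule polynomial_fun_comp [OF _ bound])
      (intro polynomial_fun_intros polynomial_fun_time polynomial_fun_round_time)
  then obtain q where q: "\<And>n. poly q n = ?space (bound n)"
    unfolding polynomial_fun_def by metis
  show ?thesis
  proof (rule exI [of _ program], rule exI [of _ p], rule exI [of _ q], rule allI)
    fix \<phi> :: xor_cnf
    let ?n = "size (enc_cnf \<phi>)" and ?s = "initial_store (enc_cnf \<phi>)"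
    let ?us = "enum_span (sig_basis \<phi>)"
    define z where "z = bound ?n"
    have "length \<phi> \<le> ?n"
      using cnf_size_le_size_enc [of \<phi>] by simp
    then have "length \<phi> * (2 * length \<phi> + 1) \<le> ?n * (2 * ?n + 1)"
      by (intro mult_le_mono) auto
    then have room: "room (length \<phi>) z" and size: "?n < z"
      unfolding room_def z_def bound_def by auto
    have us: "hd ?us = replicate (length \<phi>) 0"
      using hd_enum_span [of "sig_basis \<phi>"] by (simp add: sig_basis)
    obtain tr1 where tr1: "exec prepare_com ?s tr1 (main_store \<phi> (hd ?us) True)"
      "outputs tr1 = []" "sum_list (map cost tr1) \<le> time prepare_com z"
      using timed_prepare_com [OF room size] unfolding timed_def runs_def us by blast
    obtain tr2 t where tr2: "exec (While (Var 16) round_com) (main_store \<phi> (hd ?us) True) tr2 t"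
      "outputs tr2 = map (\<lambda>u. enc_signature (output_vec \<phi> u)) ?us"
      "\<And>n d. d \<in> set (delays_from n tr2) \<Longrightarrow> d \<le> max n (round_time z) + round_time z"
      "\<And>ev. ev \<in> set tr2 \<Longrightarrow>
        space program (store_after ev) \<le> card (com_vars program) * z + round_time z"
      using exec_enumerate [OF room size next_path_enum_span [OF sig_basis(1)], of program]
        length_span [OF sig_basis(1)] by (auto simp: sig_basis)
    have "exec program ?s (tr1 @ tr2) t"
      unfolding program_def using tr1(1) tr2(1) by (rule exec.Seq)
    moreover have "outputs (tr1 @ tr2) = map enc_signature (map (output_vec \<phi>) ?us)"
      using tr1 tr2 by simp
    moreover have "delay_bounded (tr1 @ tr2) (poly p ?n)"
      unfolding delay_bounded_def delays_def delays_from_silent [OF tr1(2)] p z_def [symmetric]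
      using tr1(3) tr2(3) by fastforce
    moreover have "space_bounded program ?s (tr1 @ tr2) (poly q ?n)"
    proof -
      have "fits z ?s"
        using size unfolding initial_store_def by (intro fits_upd fits_NIL) auto
      then have "space program ?s \<le> card (com_vars program) * z"
        by (rule space_fits)
      then show ?thesis
        unfolding space_bounded_def q z_def [symmetric]
        using space_after_exec [OF tr1(1), of program] tr1(3) tr2(4) by fastforce
    qed
    moreover have "set (map (output_vec \<phi>) ?us) = signatures \<phi>"
      by (simp add: signatures_eq_span)
    ultimately show "\<exists>tr t \<sigma>s. exec program ?s tr t \<and> outputs tr = map enc_signature \<sigma>s \<and>
        distinct \<sigma>s \<and> set \<sigma>s = signatures \<phi> \<and>
        delay_bounded tr (poly p ?n) \<and> space_bounded program ?s tr (poly q ?n)"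
      using distinct_outputs by blast
  qed
qed

end
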